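(* Let $A\in\{0,1\}^\omega$. There is a set $B$ such that $A\le_{tt(tu)}B$ if and only if $A$ is Schnorr trivial.
   Context: "Recursive" means computable. Sets are subsets of $\omega$, identified with elements of $\{0,1\}^\omega$; $A\upharpoonright n=A(0)\cdots A(n-1)$. An order function is a recursive nondecreasing unbounded function $h:\omega\to\omega$. Use: if $\Phi$ is a Turing reduction with $\Phi^B=A$, where before computing $\Phi^B(n)$ the machine first computes $\Phi^B(m)$ for all $m<n$, then the use function is $\varphi(n)=m+1$ where $m$ is the largest number queried while computing $A\upharpoonright n$ (and $0$ if there are no queries). $A\le_{tt}B$ iff there is a Turing reduction $\Phi$ such that $\Phi^X$ is total for all $X$ and $\Phi^B=A$. $A\le_{tt(tu)}B$ means: for every order function $h$ there is such a reduction $\Phi$ (total for all oracles, with $\Phi^B=A$) whose use function is bounded by $h$. Schnorr triviality (Downey–Griffiths): for a machine $M$ (partial recursive $\{0,1\}^*\to\{0,1\}^*$), $C_M(\sigma)$ is the length of a shortest $\tau$ with $M(\tau)=\sigma$ ($\infty$ if none). A set $S$ is Schnorr trivial if for every prefix-free machine $M$ whose domain has recursive measure $\sum_{\tau\in\mathrm{dom} M}2^{-|\tau|}$ there are a prefix-free machine $N$ whose domain has recursive measure and a constant $c$ such that $C_N(S\upharpoonright n)\le C_M(n)+c$ for all $n$ (numbers are identified with strings). By a theorem of Franklin and Stephan this is equivalent to the truth-table degree of $S$ being recursively traceable: there is an order $h$ such that for every function $f\le_{tt}S$ there is a recursive sequence of (canonical indices of) finite sets $\langle T_n\rangle$ with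 $f(n)\in T_n$ and $|T_n|\le h(n)$ for all $n$. *)

theory Defs
  imports Complex_Main "HOL-Library.Extended_Nat" "HOL-Library.Sublist" "HOL-Analysis.Infinite_Sum"
begin

section \<open>Oracle programs\<close>

text \<open>
  The machine model is that of Kleene's \<open>\<mu>\<close>-recursive schemes with an additional instruction
  that queries the oracle. Arities are implicit: a program is run on an argument list and has no
  value on a list of unsuitable length.
\<close>

datatype program =
    Zero
  | Succ
  | Proj nat
  | Query
  | Comp program "program list"
  | PrimRec program program
  | Mu program

text \<open>
  \<open>computes X p xs y Q\<close>: with oracle \<open>X\<close>, program \<open>p\<close> halts on arguments \<open>xs\<close> with value \<open>y\<close>,
  and \<open>Q\<close> is the set of numbers queried during this computation. Evaluation is eager, except that
  primitive recursion on the argument \<open>0\<close> does not run the step program; hence case distinctions,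
  and so arbitrary adaptive query strategies, can be programmed without spurious queries.
\<close>

inductive computes :: "nat set \<Rightarrow> program \<Rightarrow> nat list \<Rightarrow> nat \<Rightarrow> nat set \<Rightarrow> bool" for X where
  zero: "computes X Zero xs 0 {}"
| succ: "computes X Succ [x] (Suc x) {}"
| proj: "i < length xs \<Longrightarrow> computes X (Proj i) xs (xs ! i) {}"
| query: "computes X Query [x] (of_bool (x \<in> X)) {x}"
| comp: "\<lbrakk>length ys = length gs; \<forall>i<length gs. computes X (gs ! i) xs (ys ! i) (Qs i);
          computes X f ys z Q\<rbrakk>
        \<Longrightarrow> computes X (Comp f gs) xs z ((\<Union>i<length gs. Qs i) \<union> Q)"
| primrec_0: "computes X f xs y Q \<Longrightarrow> computes X (PrimRec f g) (0 # xs) y Q"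
| primrec_Suc: "\<lbrakk>computes X (PrimRec f g) (n # xs) y Q; computes X g (n # y # xs) z R\<rbrakk>
        \<Longrightarrow> computes X (PrimRec f g) (Suc n # xs) z (Q \<union> R)"
| mu: "\<lbrakk>\<forall>m<n. computes X f (m # xs) (Suc (ys m)) (Qs m); computes X f (n # xs) 0 Q\<rbrakk>
        \<Longrightarrow> computes X (Mu f) xs n ((\<Union>m<n. Qs m) \<union> Q)"

inductive_cases Zero_E: "computes X Zero xs y Q"
inductive_cases Succ_E: "computes X Succ xs y Q"
inductive_cases Proj_E: "computes X (Proj i) xs y Q"
inductive_cases Query_E: "computes X Query xs y Q"
inductive_cases Comp_E: "computes X (Comp f gs) xs y Q"
inductive_cases PrimRec_0_E: "computes X (PrimRec f g) (0 # xs) y Q"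
inductive_cases PrimRec_Suc_E: "computes X (PrimRec f g) (Suc n # xs) y Q"
inductive_cases Mu_E: "computes X (Mu f) xs y Q"

lemma computes_deterministic:
  "computes X p xs y Q \<Longrightarrow> computes X p xs y' Q' \<Longrightarrow> y = y' \<and> Q = Q'"
proof (induction arbitrary: y' Q' rule: computes.induct)
  case (comp ys gs xs Qs f z Q)
  from comp.prems obtain ys' Qs' Q1 where
    1: "length ys' = length gs" "\<forall>i<length gs. computes X (gs ! i) xs (ys' ! i) (Qs' i)"
      "computes X f ys' y' Q1" "Q' = (\<Union>i<length gs. Qs' i) \<union> Q1"
    by (auto elim: Comp_E)
  have 2: "ys ! i = ys' ! i \<and> Qs i = Qs' i" if "i < length gs" for i
    using comp.IH(1) 1(2) that by blast
  then have "ys = ys'" using comp.hyps(1) 1(1) by (auto intro: nth_equalityI)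
  then show ?case using comp.IH(2) 1 2 by auto
next
  case (mu n f xs ys Qs Q)
  from mu.prems obtain ys' Qs' Q1 where
    1: "\<forall>m<y'. computes X f (m # xs) (Suc (ys' m)) (Qs' m)" "computes X f (y' # xs) 0 Q1"
      "Q' = (\<Union>m<y'. Qs' m) \<union> Q1"
    by (auto elim: Mu_E)
  have "\<not> n < y'" using mu.IH(2) 1(1) by blast
  moreover have "\<not> y' < n" using mu.IH(1) 1(2) by blast
  ultimately have n: "n = y'" by simp
  have "Qs m = Qs' m" if "m < n" for m
    using mu.IH(1) 1(1) that n by blast
  then show ?case using mu.IH(2) 1 n by auto
next
  case (primrec_Suc f g n xs y Q z R)
  from primrec_Suc.prems obtain y1 Q1 R1 where
    1: "computes X (PrimRec f g) (n # xs) y1 Q1" "computes X g (n # y1 # xs) y' R1" "Q' = Q1 \<union> R1"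
    by (auto elim: PrimRec_Suc_E)
  then show ?case using primrec_Suc.IH by metis
qed (blast elim: Zero_E Succ_E Proj_E Query_E PrimRec_0_E)+

primrec oracle_free :: "program \<Rightarrow> bool" where
  "oracle_free Zero \<longleftrightarrow> True"
| "oracle_free Succ \<longleftrightarrow> True"
| "oracle_free (Proj i) \<longleftrightarrow> True"
| "oracle_free Query \<longleftrightarrow> False"
| "oracle_free (Comp f gs) \<longleftrightarrow> oracle_free f \<and> list_all id (map oracle_free gs)"
| "oracle_free (PrimRec f g) \<longleftrightarrow> oracle_free f \<and> oracle_free g"
| "oracle_free (Mu f) \<longleftrightarrow> oracle_free f"

lemma computes_oracle_free:
  "computes X p xs y Q \<Longrightarrow> oracle_free p \<Longrightarrow> Q = {} \<and> computes Y p xs y {}"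
proof (induction rule: computes.induct)
  case (comp ys gs xs Qs f z Q)
  have "\<forall>i<length gs. Qs i = {} \<and> computes Y (gs ! i) xs (ys ! i) {}"
    using comp.IH(1) comp.prems by (auto simp: list_all_length)
  moreover have "Q = {} \<and> computes Y f ys z {}" using comp by simp
  ultimately show ?case
    using computes.comp[of ys gs Y xs "\<lambda>_. {}" f z "{}"] comp.hyps(1) by auto
next
  case (primrec_Suc f g n xs y Q z R)
  then show ?case using computes.primrec_Suc[of Y f g n xs y "{}" z "{}"] by auto
next
  case (mu n f xs ys Qs Q)
  then show ?case using computes.mu[of n Y f xs ys "\<lambda>_. {}" "{}"] by auto
qed (auto intro: computes.intros)

section \<open>Recursive functions, order functions, recursive reals\<close>

definition recursive :: "(nat \<Rightarrow> nat) \<Rightarrow> bool" where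
  "recursive f \<longleftrightarrow> (\<exists>p. oracle_free p \<and> (\<forall>n. computes {} p [n] (f n) {}))"

definition order_function :: "(nat \<Rightarrow> nat) \<Rightarrow> bool" where
  "order_function h \<longleftrightarrow> recursive h \<and> mono h \<and> (\<forall>b. \<exists>n. b < h n)"

text \<open>
  A real is recursive if some recursive sequence of rationals converges to it with modulus
  \<open>2\<^sup>-\<^sup>n\<close>; the \<open>n\<close>-th rational is presented as \<open>(a n - b n) / (d n + 1)\<close>.
\<close>

definition recursive_real :: "real \<Rightarrow> bool" where
  "recursive_real r \<longleftrightarrow> (\<exists>a b d. recursive a \<and> recursive b \<and> recursive d \<and>
     (\<forall>n. \<bar>r - (real (a n) - real (b n)) / real (Suc (d n))\<bar> \<le> (1 / 2) ^ n))"

section \<open>Truth-table reductions with tiny use\<close>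

definition total_for_all_oracles :: "program \<Rightarrow> bool" where
  "total_for_all_oracles p \<longleftrightarrow> (\<forall>X n. \<exists>y Q. computes X p [n] y Q)"

definition reduces :: "program \<Rightarrow> nat set \<Rightarrow> nat set \<Rightarrow> bool" where
  "reduces p B A \<longleftrightarrow> (\<forall>n. \<exists>Q. computes B p [n] (of_bool (n \<in> A)) Q)"

definition queries :: "nat set \<Rightarrow> program \<Rightarrow> nat \<Rightarrow> nat set" where
  "queries B p n = (THE Q. \<exists>y. computes B p [n] y Q)"

text \<open>
  The convention that a machine computes the values at all \<open>m < n\<close> before the value at \<open>n\<close> is
  implemented by collecting the queries of the runs on \<open>0, \<dots>, n - 1\<close>, which are the numbers queried
  while computing the first \<open>n\<close> bits. The set is finite whenever these runs halt.
\<close>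

definition use_function :: "nat set \<Rightarrow> program \<Rightarrow> nat \<Rightarrow> nat" where
  "use_function B p n =
     (let Q = (\<Union>k<n. queries B p k) in if Q = {} then 0 else Max Q + 1)"

definition tt_tu_reducible :: "nat set \<Rightarrow> nat set \<Rightarrow> bool"  (infix "\<le>\<^sub>t\<^sub>t\<^sub>t\<^sub>u" 50) where
  "A \<le>\<^sub>t\<^sub>t\<^sub>t\<^sub>u B \<longleftrightarrow> (\<forall>h. order_function h \<longrightarrow>
     (\<exists>p. total_for_all_oracles p \<and> reduces p B A \<and> (\<forall>n. use_function B p n \<le> h n)))"

section \<open>Prefix-free machines and Schnorr triviality\<close>

text \<open>
  Binary strings are identified with numbers along the length-lexicographic ordering, i.e. the
  string \<open>\<sigma>\<close> corresponds to \<open>n\<close> where \<open>1\<sigma>\<close> is the binary expansion of \<open>n + 1\<close>.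
\<close>

definition nat_of_string :: "bool list \<Rightarrow> nat" where
  "nat_of_string \<sigma> = foldl (\<lambda>n b. 2 * n + 1 + of_bool b) 0 \<sigma>"

definition string_of_nat :: "nat \<Rightarrow> bool list" where
  "string_of_nat = inv nat_of_string"

lemma bij_nat_of_string: "bij nat_of_string"
proof (rule bijI)
  show "inj nat_of_string"
  proof (rule injI)
    fix \<sigma> \<tau> assume "nat_of_string \<sigma> = nat_of_string \<tau>"
    then show "\<sigma> = \<tau>"
    proof (induction \<sigma> arbitrary: \<tau> rule: rev_induct)
      case Nil
      then show ?case by (cases \<tau> rule: rev_cases) (auto simp: nat_of_string_def)
    next
      case (snoc b \<sigma>)
      show ?case
      proof (cases \<tau> rule: rev_cases)
        case Nil
        then show ?thesis using snoc.prems by (auto simp: nat_of_string_def)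
      next
        case (snoc \<tau>' c)
        have "2 * nat_of_string \<sigma> + 1 + of_bool b = 2 * nat_of_string \<tau>' + 1 + of_bool c"
          using snoc.prems snoc by (simp add: nat_of_string_def)
        then have "b = c \<and> nat_of_string \<sigma> = nat_of_string \<tau>'"
          by (cases b; cases c) (simp_all, presburger+)
        then show ?thesis using snoc.IH snoc by simp
      qed
    qed
  qed
  show "surj nat_of_string"
  proof (rule surjI)
    fix n show "nat_of_string (SOME \<sigma>. nat_of_string \<sigma> = n) = n"
    proof (rule someI_ex)
      show "\<exists>\<sigma>. nat_of_string \<sigma> = n"
      proof (induction n rule: less_induct)
        case (less n)
        show ?case
        proof (cases "n = 0")
          case True
          then show ?thesis by (auto simp: nat_of_string_def intro: exI[of _ "[]"])
        next
          case False
          then have "(n - 1) div 2 < n" by linarith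
          then obtain \<sigma> where "nat_of_string \<sigma> = (n - 1) div 2"
            using less.IH by blast
          then have "nat_of_string (\<sigma> @ [even n]) = 2 * ((n - 1) div 2) + 1 + of_bool (even n)"
            by (simp add: nat_of_string_def)
          also have "\<dots> = n" using False by (cases "even n") (simp_all, presburger+)
          finally show ?thesis by blast
        qed
      qed
    qed
  qed
qed

definition partial_recursive :: "(bool list \<rightharpoonup> bool list) \<Rightarrow> bool" where
  "partial_recursive M \<longleftrightarrow> (\<exists>p. oracle_free p \<and>
     (\<forall>\<tau> \<sigma>. M \<tau> = Some \<sigma> \<longleftrightarrow> computes {} p [nat_of_string \<tau>] (nat_of_string \<sigma>) {}))"

definition prefix_free :: "bool list set \<Rightarrow> bool" where
  "prefix_free D \<longleftrightarrow> (\<forall>\<sigma>\<in>D. \<forall>\<tau>\<in>D. prefix \<sigma> \<tau> \<longrightarrow> \<sigma> = \<tau>)"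

definition prefix_free_machine :: "(bool list \<rightharpoonup> bool list) \<Rightarrow> bool" where
  "prefix_free_machine M \<longleftrightarrow> partial_recursive M \<and> prefix_free (dom M)"

text \<open>For a prefix-free domain the sum converges by Kraft's inequality.\<close>

definition domain_measure :: "(bool list \<rightharpoonup> bool list) \<Rightarrow> real" where
  "domain_measure M = (\<Sum>\<^sub>\<infinity>\<tau>\<in>dom M. (1 / 2) ^ length \<tau>)"

text \<open>In \<^typ>\<open>enat\<close> the infimum of the empty set is \<open>\<infinity>\<close>.\<close>

definition complexity :: "(bool list \<rightharpoonup> bool list) \<Rightarrow> bool list \<Rightarrow> enat" where
  "complexity M \<sigma> = (INF \<tau>\<in>{\<tau>. M \<tau> = Some \<sigma>}. enat (length \<tau>))"

definition initial_segment :: "nat set \<Rightarrow> nat \<Rightarrow> bool list" where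
  "initial_segment S n = map (\<lambda>i. i \<in> S) [0..<n]"

definition Schnorr_trivial :: "nat set \<Rightarrow> bool" where
  "Schnorr_trivial S \<longleftrightarrow>
     (\<forall>M. prefix_free_machine M \<and> recursive_real (domain_measure M) \<longrightarrow>
       (\<exists>N c. prefix_free_machine N \<and> recursive_real (domain_measure N) \<and>
         (\<forall>n. complexity N (initial_segment S n) \<le> complexity M (string_of_nat n) + enat c)))"

end

theory Submission
  imports Defs "HOL-Library.Nat_Bijection" "HOL-Library.Countable"
    "HOL-Analysis.Elementary_Metric_Spaces"
begin

text \<open>
  Suppose that \<open>A\<close> is reducible to some \<open>B\<close> with tiny use. If the use is bounded by \<open>h\<close>, there are at
  most \<open>2\<^sup>h\<^sup>(\<^sup>n\<^sup>)\<close> candidates for the first \<open>n\<close> bits of \<open>A\<close>, one for each oracle below \<open>h n\<close>. Since the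
  domain of a given machine \<open>M\<close> has recursive measure, \<open>h\<close> can be chosen to grow so slowly that
  giving each candidate for \<open>n\<close> the weight of each description of \<open>n\<close> still yields a finite,
  recursive sum; a Kraft--Chaitin type construction turns these weights into the machine \<open>N\<close>.

  Conversely, for a Schnorr trivial \<open>A\<close> and a recursive \<open>g\<close>, the first \<open>g k\<close> bits of \<open>A\<close> have
  descriptions of length at most \<open>k + c\<close> with respect to a machine whose domain has recursive
  measure and hence is decidable. For each order function \<open>h\<close>, let \<open>g\<close> grow rapidly compared with
  \<open>h\<close> and store these descriptions in a column of \<open>B\<close> reserved for \<open>h\<close>.
\<close>

section \<open>Closure properties of the recursive functions\<close>

text \<open>Both directions replace a machine by a total recursive function, for one reason: once
  the strings found to halt leave less than 2^-k of the measure unaccounted for, no other string of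
  length k halts. The same stages bound the weight of all later strings.

  Totality on all oracles shapes the rest. It lets candidates be computed from finite oracles that
  have nothing to do with \<open>B\<close>, so the number of requests is known in advance and the
  measure of \<open>N\<close> is recursive. Conversely, the reduction has to halt on oracles without
  the intended form; it therefore never searches its column for a code, but reads a whole block and
  adds up the contributions.

  The function \<open>g\<close> is fixed before Schnorr triviality yields the constant
  \<open>c\<close> and before a column is assigned. Blocks of about 4^k codes outgrow 2^(k + c), and
  the finitely many earlier bits are built into the reduction. The order functions have no effective
  list, but \<open>B\<close> need not be effective, so its columns are filled by choice.\<close>

lemma computes_comp:
  assumes "list_all2 (\<lambda>g y. computes {} g xs y {}) gs ys" "computes {} f ys z {}"
  shows "computes {} (Comp f gs) xs z {}"
  using computes.comp[of ys gs "{}" xs "\<lambda>_. {}" f z "{}"] assms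
  by (simp add: list_all2_conv_all_nth)

lemma computes_primrec_Suc:
  "\<lbrakk>computes {} (PrimRec f g) (n # xs) y {}; computes {} g (n # y # xs) z {}\<rbrakk>
     \<Longrightarrow> computes {} (PrimRec f g) (Suc n # xs) z {}"
  using computes.primrec_Suc by fastforce

lemma computes_proj: "i < length xs \<Longrightarrow> y = xs ! i \<Longrightarrow> computes {} (Proj i) xs y {}"
  by (simp add: computes.proj)

lemmas computes_basic =
  computes_comp computes.zero computes.succ computes_proj

section \<open>Addition, pairing and truncated subtraction as programs\<close>

definition add_program :: program where
  "add_program = PrimRec (Proj 0) (Comp Succ [Proj 1])"

text \<open>Triangular numbers underlie Cantor's pairing \<open>prod_encode\<close>, in computing it
  as well as in inverting it.\<close>

definition triangle_program :: program where
  "triangle_program = PrimRec Zero (Comp add_program [Proj 1, Comp Succ [Proj 0]])"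

definition pair_program :: program where
  "pair_program = Comp add_program [Comp triangle_program [add_program], Proj 0]"

text \<open>Takes the subtrahend as its first argument.\<close>

definition monus_program :: program where
  "monus_program = PrimRec (Proj 0) (Comp (PrimRec Zero (Proj 0)) [Proj 1])"

lemma oracle_free_programs [simp]:
  "oracle_free add_program" "oracle_free triangle_program"
  "oracle_free pair_program" "oracle_free monus_program"
  by (simp_all add: add_program_def triangle_program_def pair_program_def monus_program_def)

lemma computes_add: "computes {} add_program [a, b] (a + b) {}"
proof (induction a)
  case 0
  then show ?case by (auto simp: add_program_def intro!: computes.primrec_0 computes_proj)
next
  case (Suc a)
  then show ?case unfolding add_program_def
    by (auto intro!: computes_primrec_Suc[where y = "a + b"] computes_basic
        simp: list_all2_Cons1)
qed

lemma computes_triangle: "computes {} triangle_program [n] (triangle n) {}"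
proof (induction n)
  case 0
  then show ?case by (auto simp: triangle_program_def intro!: computes.primrec_0 computes.zero)
next
  case (Suc n)
  have "computes {} (Comp add_program [Proj 1, Comp Succ [Proj 0]]) [n, triangle n]
      (triangle n + Suc n) {}"
    by (intro computes_comp[where ys = "[triangle n, Suc n]"] computes_add)
      (auto intro!: computes_basic simp: list_all2_Cons1)
  then show ?case using Suc unfolding triangle_program_def
    by (auto intro: computes_primrec_Suc)
qed

lemma computes_pair: "computes {} pair_program [a, b] (prod_encode (a, b)) {}"
proof -
  have "computes {} (Comp triangle_program [add_program]) [a, b] (triangle (a + b)) {}"
    by (rule computes_comp[where ys = "[a + b]"]) (auto intro!: computes_add computes_triangle)
  then show ?thesis unfolding pair_program_def prod_encode_def prod.case
    by (intro computes_comp[where ys = "[triangle (a + b), a]"])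
      (auto intro!: computes_add computes_proj)
qed

lemma computes_monus: "computes {} monus_program [b, a] (a - b) {}"
proof (induction b)
  case 0
  then show ?case by (auto simp: monus_program_def intro!: computes.primrec_0 computes_proj)
next
  case (Suc b)
  have 1: "computes {} (PrimRec Zero (Proj 0)) [n] (n - 1) {}" for n
  proof (induction n)
    case 0
    then show ?case by (auto intro!: computes.primrec_0 computes.zero)
  next
    case (Suc n)
    then show ?case
      by (intro computes_primrec_Suc[where y = "n - 1"]) (simp_all add: computes_proj)
  qed
  have "computes {} (Comp (PrimRec Zero (Proj 0)) [Proj 1]) [b, a - b, a] (a - b - 1) {}"
    using 1 by (intro computes_comp[where ys = "[a - b]"])
      (simp_all add: computes_proj del: One_nat_def diff_diff_left)
  then show ?case using Suc unfolding monus_program_def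
    by (intro computes_primrec_Suc[where y = "a - b"]) simp_all
qed

lemma recursive_binary:
  assumes p: "oracle_free p" "\<And>a b. computes {} p [a, b] (f a b) {}"
    and a: "recursive a" and b: "recursive b"
  shows "recursive (\<lambda>x. f (a x) (b x))"
proof -
  obtain q r where "oracle_free q" "\<And>n. computes {} q [n] (a n) {}"
    "oracle_free r" "\<And>n. computes {} r [n] (b n) {}"
    using a b by (auto simp: recursive_def)
  then show ?thesis using p unfolding recursive_def
    by (intro exI[of _ "Comp p [q, r]"]) (auto intro!: computes_comp[where ys = "[a x, b x]" for x])
qed

lemma recursive_comp:
  assumes "recursive f" "recursive g"
  shows "recursive (\<lambda>x. f (g x))"
proof -
  obtain q r where "oracle_free q" "\<And>n. computes {} q [n] (f n) {}"
    "oracle_free r" "\<And>n. computes {} r [n] (g n) {}"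
    using assms by (auto simp: recursive_def)
  then show ?thesis unfolding recursive_def
    by (intro exI[of _ "Comp q [r]"]) (auto intro!: computes_comp[where ys = "[g x]" for x])
qed

lemma recursive_id: "recursive (\<lambda>x. x)"
  unfolding recursive_def by (intro exI[of _ "Proj 0"]) (auto intro!: computes_proj)

lemma recursive_Suc: "recursive f \<Longrightarrow> recursive (\<lambda>x. Suc (f x))"
  by (rule recursive_comp[of Suc])
    (auto simp: recursive_def intro!: exI[of _ Succ] computes.succ)

lemma recursive_const: "recursive (\<lambda>x. c)"
proof (induction c)
  case 0
  then show ?case by (auto simp: recursive_def intro!: exI[of _ Zero] computes.zero)
qed (rule recursive_Suc)

lemmas recursive_add = recursive_binary[OF oracle_free_programs(1) computes_add]
  and recursive_prod_encode =
    recursive_binary[OF oracle_free_programs(3) computes_pair]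

lemma recursive_minus:
  assumes "recursive a" "recursive b" shows "recursive (\<lambda>x. a x - b x)"
  by (rule recursive_binary[of monus_program "\<lambda>b a. a - b" b a, OF _ computes_monus assms(2,1)])
    simp

lemma recursive_triangle: "recursive a \<Longrightarrow> recursive (\<lambda>x. triangle (a x))"
  by (rule recursive_comp[of triangle])
    (auto simp: recursive_def intro!: exI[of _ triangle_program] computes_triangle)

text \<open>\<open>Mu\<close> stops at the value 0, hence the characteristic function of the
  negation.\<close>

lemma Least_computes:
  assumes P: "\<exists>n. P n" and "\<And>n. computes {} p (n # xs) (of_bool (\<not> P n)) {}"
  shows "computes {} (Mu p) xs (LEAST n. P n) {}"
proof -
  have "\<forall>m<(LEAST n. P n). computes {} p (m # xs) (Suc 0) {}"
  proof (intro allI impI)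
    fix m assume "m < (LEAST n. P n)"
    then have "\<not> P m" by (rule not_less_Least)
    then show "computes {} p (m # xs) (Suc 0) {}" using assms(2)[of m] by simp
  qed
  moreover have "computes {} p ((LEAST n. P n) # xs) 0 {}"
    using assms(2)[of "LEAST n. P n"] LeastI_ex[OF P] by simp
  ultimately show ?thesis
    using computes.mu[of "LEAST n. P n" "{}" p xs "\<lambda>_. 0" "\<lambda>_. {}" "{}"] by simp
qed

definition recursive_pred :: "(nat \<Rightarrow> bool) \<Rightarrow> bool" where
  "recursive_pred P \<longleftrightarrow> recursive (\<lambda>x. of_bool (P x))"

abbreviation pfst :: "nat \<Rightarrow> nat" where "pfst z \<equiv> fst (prod_decode z)"
abbreviation psnd :: "nat \<Rightarrow> nat" where "psnd z \<equiv> snd (prod_decode z)"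

lemma of_bool_not_nat: "(of_bool (\<not> P) :: nat) = 1 - of_bool P"
  by simp

lemma recursive_pred_not: "recursive_pred P \<Longrightarrow> recursive_pred (\<lambda>x. \<not> P x)"
  unfolding recursive_pred_def of_bool_not_nat
  by (intro recursive_minus recursive_const)

text \<open>
  Functions of several arguments are treated as functions of a single argument, a nested pair;
  in the rules for binders the bound variable becomes the first component of such a pair.
\<close>

lemma recursive_Least:
  assumes "\<And>x. \<exists>n. P n x" and P: "recursive_pred (\<lambda>z. P (pfst z) (psnd z))"
  shows "recursive (\<lambda>x. LEAST n. P n x)"
proof -
  obtain p where p: "oracle_free p"
    "\<And>z. computes {} p [z] (of_bool (\<not> P (pfst z) (psnd z))) {}"
    using recursive_pred_not[OF P] by (auto simp: recursive_def recursive_pred_def)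
  have "computes {} (Comp p [pair_program]) [n, x] (of_bool (\<not> P n x)) {}" for n x
    using p(2)[of "prod_encode (n, x)"]
    by (auto intro!: computes_comp[where ys = "[prod_encode (n, x)]"] computes_pair)
  then have "computes {} (Mu (Comp p [pair_program])) [x] (LEAST n. P n x) {}" for x
    using assms(1) by (intro Least_computes) auto
  then show ?thesis unfolding recursive_def using p(1)
    by (intro exI[of _ "Mu (Comp p [pair_program])"]) auto
qed

section \<open>Inverting the pairing function\<close>

lemma triangle_mono: "mono triangle"
  by (rule monoI) (unfold triangle_def, intro div_le_mono mult_le_mono, auto)

text \<open>The least \<open>s\<close> is the diagonal a + b of the pair coded by z; subtracting its
  triangular number from z leaves a. The program is written out by hand, since using
  \<open>recursive_Least\<close> presupposes closure under \<open>pfst\<close> and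
  \<open>psnd\<close>, which is derived from this.\<close>

lemma computes_Least_triangle:
  "\<exists>p. oracle_free p \<and> (\<forall>z. computes {} p [z] (LEAST s. z < triangle (Suc s)) {})"
proof -
  let ?q = "Comp monus_program [Comp triangle_program [Comp Succ [Proj 0]], Comp Succ [Proj 1]]"
  \<comment> \<open>Subtracting twice from 1 turns \<open>Suc z - triangle (Suc s)\<close> into a
    truth value, with 0 exactly where \<open>Mu\<close> has to stop.\<close>
  let ?r = "Comp monus_program [Comp monus_program [?q, Comp Succ [Zero]], Comp Succ [Zero]]"
  have q: "computes {} ?q [s, z] (Suc z - triangle (Suc s)) {}" for s z
  proof -
    have S: "computes {} (Comp Succ [Proj i]) xs (Suc (xs ! i)) {}" if "i < length xs" for i xs
      using that by (intro computes_comp[where ys = "[xs ! i]"])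
        (auto intro: computes_proj computes.succ)
    have "computes {} (Comp triangle_program [Comp Succ [Proj 0]]) [s, z] (triangle (Suc s)) {}"
      using S[of 0 "[s, z]"] by (intro computes_comp[where ys = "[Suc s]"] computes_triangle) simp
    then show ?thesis using S[of 1 "[s, z]"]
      by (intro computes_comp[where ys = "[triangle (Suc s), Suc z]"] computes_monus) simp
  qed
  have 1: "computes {} (Comp Succ [Zero]) xs 1 {}" for xs
    by (rule computes_comp[where ys = "[0]"]) (auto intro!: computes_basic)
  have r: "computes {} ?r [s, z] (1 - (1 - (Suc z - triangle (Suc s)))) {}" for s z
  proof -
    have "computes {} (Comp monus_program [?q, Comp Succ [Zero]]) [s, z]
        (1 - (Suc z - triangle (Suc s))) {}"
      using q 1 by (intro computes_comp[where ys = "[Suc z - triangle (Suc s), 1]"] computes_monus)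
        simp
    then show ?thesis using 1
      by (intro computes_comp[where ys = "[1 - (Suc z - triangle (Suc s)), 1]"] computes_monus)
        simp
  qed
  have *: "1 - (1 - (Suc z - triangle (Suc s))) = of_bool (\<not> z < triangle (Suc s))" for s z
    by auto
  have "\<exists>s. z < triangle (Suc s)" for z
    by (rule exI[of _ z]) (induction z, auto)
  then have "computes {} (Mu ?r) [z] (LEAST s. z < triangle (Suc s)) {}" for z
    using r[unfolded *] by (intro Least_computes) auto
  then show ?thesis by (intro exI[of _ "Mu ?r"]) auto
qed

lemma Least_triangle:
  "(LEAST s. prod_encode (a, b) < triangle (Suc s)) = a + b"
proof (rule Least_equality)
  show "prod_encode (a, b) < triangle (Suc (a + b))" by (simp add: prod_encode_def)
next
  fix s assume s: "prod_encode (a, b) < triangle (Suc s)"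
  show "a + b \<le> s"
  proof (rule ccontr)
    assume "\<not> a + b \<le> s"
    then have "triangle (Suc s) \<le> triangle (a + b)" by (intro monoD[OF triangle_mono]) simp
    then show False using s by (simp add: prod_encode_def)
  qed
qed

lemma
  assumes "recursive a"
  shows recursive_pfst: "recursive (\<lambda>x. pfst (a x))"
    and recursive_psnd: "recursive (\<lambda>x. psnd (a x))"
proof -
  define L where "L z = (LEAST s. z < triangle (Suc s))" for z
  have L: "recursive L" using computes_Least_triangle by (auto simp: recursive_def L_def)
  have *: "L z = pfst z + psnd z" for z
    using Least_triangle[of "pfst z" "psnd z"] by (simp add: L_def)
  have "pfst z = z - triangle (L z) \<and> psnd z = L z - (z - triangle (L z))" for z
  proof -
    have "z = triangle (pfst z + psnd z) + pfst z"
      using prod_decode_inverse[of z] unfolding prod_encode_def by (simp add: case_prod_unfold)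
    then show ?thesis using * by (metis add_diff_cancel_left')
  qed
  then have pq: "pfst = (\<lambda>z. z - triangle (L z))" "psnd = (\<lambda>z. L z - (z - triangle (L z)))"
    by auto
  have "recursive pfst" "recursive psnd" unfolding pq
    by (intro recursive_minus recursive_triangle recursive_id L[THEN recursive_comp])+
  from this[THEN recursive_comp, OF assms]
  show "recursive (\<lambda>x. pfst (a x))" "recursive (\<lambda>x. psnd (a x))" .
qed

lemma recursive_rec_nat:
  assumes a: "recursive a"
    and g: "recursive (\<lambda>z. g (pfst z) (pfst (psnd z)) (psnd (psnd z)))"
    and n: "recursive n"
  shows "recursive (\<lambda>x. rec_nat (a x) (\<lambda>i y. g i y x) (n x))"
proof -
  obtain pa where pa: "oracle_free pa" "\<And>x. computes {} pa [x] (a x) {}"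
    using a by (auto simp: recursive_def)
  obtain pg where pg: "oracle_free pg"
    "\<And>z. computes {} pg [z] (g (pfst z) (pfst (psnd z)) (psnd (psnd z))) {}"
    using g by (auto simp: recursive_def)
  let ?G = "Comp pg [Comp pair_program [Proj 0, Comp pair_program [Proj 1, Proj 2]]]"
  have 1: "computes {} (Comp pair_program [Proj 1, Proj 2]) [i, y, x] (prod_encode (y, x)) {}"
    for i y x
    by (intro computes_comp[where ys = "[y, x]"] computes_pair) (simp add: computes_proj)
  have 2: "computes {} (Comp pair_program [Proj 0, Comp pair_program [Proj 1, Proj 2]]) [i, y, x]
      (prod_encode (i, prod_encode (y, x))) {}" for i y x
    using 1 by (intro computes_comp[where ys = "[i, prod_encode (y, x)]"] computes_pair)
      (simp add: computes_proj)
  have G: "computes {} ?G [i, y, x] (g i y x) {}" for i y x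
    by (rule computes_comp[where ys = "[prod_encode (i, prod_encode (y, x))]"])
      (use pg(2)[of "prod_encode (i, prod_encode (y, x))"] 2 in auto)
  have "computes {} (PrimRec pa ?G) [k, x] (rec_nat (a x) (\<lambda>i y. g i y x) k) {}" for k x
  proof (induction k)
    case 0
    then show ?case by (auto intro!: computes.primrec_0 pa)
  next
    case (Suc k)
    then show ?case using G by (auto intro: computes_primrec_Suc simp del: One_nat_def)
  qed
  then show ?thesis
    by (intro recursive_binary[of "PrimRec pa ?G" "\<lambda>k x. rec_nat (a x) (\<lambda>i y. g i y x) k"])
      (use pa(1) pg(1) n recursive_id in auto)
qed

section \<open>Arithmetic and decidable predicates\<close>

lemma recursive_comp2:
  assumes f: "recursive (\<lambda>z. f (pfst z) (psnd z))" and "recursive a" "recursive b"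
  shows "recursive (\<lambda>x. f (a x) (b x))"
proof -
  have "recursive (\<lambda>x. prod_encode (a x, b x))" using assms(2,3) by (rule recursive_prod_encode)
  from recursive_comp[OF f this] show ?thesis by simp
qed

lemma recursive_mult:
  assumes "recursive a" "recursive b" shows "recursive (\<lambda>x. a x * b x)"
proof -
  have *: "m * n = rec_nat 0 (\<lambda>i y. y + n) m" for m n :: nat
    by (induction m) (simp_all add: add.commute)
  show ?thesis unfolding *
    by (intro recursive_rec_nat recursive_const recursive_add
        recursive_pfst recursive_psnd recursive_id assms(2)[THEN recursive_comp] assms)
qed

lemma recursive_power:
  assumes "recursive a" "recursive b" shows "recursive (\<lambda>x. a x ^ b x)"
proof -
  have *: "c ^ n = rec_nat 1 (\<lambda>i y. y * c) n" for c n :: nat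
    by (induction n) (simp_all add: mult.commute)
  show ?thesis unfolding *
    by (intro recursive_rec_nat recursive_const recursive_mult
        recursive_pfst recursive_psnd recursive_id assms(1)[THEN recursive_comp] assms)
qed

lemma recursive_sum:
  assumes f: "recursive (\<lambda>z. f (pfst z) (psnd z))" and n: "recursive n"
  shows "recursive (\<lambda>x. \<Sum>i<n x. f i x)"
proof -
  have *: "(\<Sum>i<k. f i x) = rec_nat 0 (\<lambda>i y. y + f i x) k" for x k
    by (induction k) simp_all
  have "recursive (\<lambda>z. prod_encode (pfst z, psnd (psnd z)))"
    by (intro recursive_prod_encode recursive_pfst recursive_psnd recursive_id)
  from recursive_comp[OF f this] have "recursive (\<lambda>z. f (pfst z) (psnd (psnd z)))"
    by simp
  then show ?thesis unfolding *
    by (intro recursive_rec_nat recursive_const recursive_add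
        recursive_pfst recursive_psnd recursive_id n)
qed

lemma recursive_of_bool: "recursive_pred P \<Longrightarrow> recursive (\<lambda>x. of_bool (P x))"
  by (simp add: recursive_pred_def)

lemma recursive_pred_conj:
  assumes "recursive_pred P" "recursive_pred Q" shows "recursive_pred (\<lambda>x. P x \<and> Q x)"
  using assms recursive_mult unfolding recursive_pred_def of_bool_conj by blast

lemma recursive_pred_disj:
  assumes "recursive_pred P" "recursive_pred Q" shows "recursive_pred (\<lambda>x. P x \<or> Q x)"
proof -
  have "recursive_pred (\<lambda>x. \<not> (\<not> P x \<and> \<not> Q x))"
    using assms by (intro recursive_pred_not recursive_pred_conj)
  then show ?thesis by simp
qed

lemma recursive_pred_less:
  assumes "recursive a" "recursive b" shows "recursive_pred (\<lambda>x. a x < b x)"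
proof -
  have "of_bool (a x < b x) = 1 - (1 - (b x - a x))" for x by auto
  then show ?thesis unfolding recursive_pred_def
    by (simp only:) (intro recursive_minus recursive_const assms)
qed

lemma recursive_pred_le:
  assumes "recursive a" "recursive b" shows "recursive_pred (\<lambda>x. a x \<le> b x)"
  unfolding not_less[symmetric] by (intro recursive_pred_not recursive_pred_less assms)

lemma recursive_pred_eq:
  assumes "recursive a" "recursive b" shows "recursive_pred (\<lambda>x. a x = b x)"
  unfolding eq_iff by (intro recursive_pred_conj recursive_pred_le assms)

lemma recursive_if:
  assumes "recursive_pred P" "recursive a" "recursive b"
  shows "recursive (\<lambda>x. if P x then a x else b x)"
proof -
  have "(if P x then a x else b x) = of_bool (P x) * a x + of_bool (\<not> P x) * b x" for x by simp
  then show ?thesis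
    by (simp only:) (intro recursive_add recursive_mult recursive_of_bool recursive_pred_not assms)
qed

lemma recursive_pred_const: "recursive_pred (\<lambda>x. c)"
  unfolding recursive_pred_def by (rule recursive_const)


lemma recursive_div:
  assumes "recursive a" "recursive b" shows "recursive (\<lambda>x. a x div b x)"
proof -
  \<comment> \<open>The disjunct \<open>b x = 0\<close> makes the search stop at 0 there, in
    agreement with division by zero.\<close>
  have *: "(LEAST q. b x = 0 \<or> a x < Suc q * b x) = a x div b x" for x
  proof (cases "b x = 0")
    case False
    then have "a x < Suc q * b x \<longleftrightarrow> a x div b x \<le> q" for q
      by (metis div_less_iff_less_mult less_Suc_eq_le not_gr_zero)
    then show ?thesis using False by (intro Least_equality) auto
  qed auto
  have ex: "\<exists>q. b x = 0 \<or> a x < Suc q * b x" for x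
  proof (cases "b x = 0")
    case False
    then have "a x < Suc (a x) * 1" "Suc (a x) * 1 \<le> Suc (a x) * b x"
      by (simp, intro mult_le_mono) auto
    then show ?thesis by (intro exI[of _ "a x"]) linarith
  qed simp
  have "recursive (\<lambda>x. LEAST q. b x = 0 \<or> a x < Suc q * b x)"
    by (rule recursive_Least, rule ex)
      (intro recursive_pred_disj recursive_pred_eq recursive_pred_less
        recursive_mult recursive_Suc recursive_const recursive_pfst recursive_id
        recursive_psnd
        assms[THEN recursive_comp])
  then show ?thesis unfolding * .
qed

lemma recursive_mod:
  assumes "recursive a" "recursive b" shows "recursive (\<lambda>x. a x mod b x)"
  unfolding minus_mult_div_eq_mod[symmetric]
  by (intro recursive_minus recursive_mult recursive_div assms)

lemmas recursive_intros =
  recursive_const recursive_pred_const recursive_id recursive_pfst recursive_psnd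
  recursive_prod_encode recursive_Suc recursive_add recursive_minus recursive_mult
  recursive_power recursive_div recursive_mod recursive_sum recursive_of_bool recursive_if
  recursive_pred_not recursive_pred_conj recursive_pred_disj
  recursive_pred_less recursive_pred_le recursive_pred_eq

text \<open>Allows finitely many bits of a possibly nonrecursive set to be built into a
  reduction.\<close>

lemma recursive_finite_support:
  assumes "finite {x. f x \<noteq> 0}" shows "recursive f"
proof -
  obtain b where b: "\<And>x. f x \<noteq> 0 \<Longrightarrow> x < b"
    using assms unfolding finite_nat_set_iff_bounded by auto
  have "recursive (\<lambda>x. if x < n then f x else 0)" for n
  proof (induction n)
    case 0
    then show ?case by (simp add: recursive_const)
  next
    case (Suc n)
    have "recursive (\<lambda>x. if x = n then f n else if x < n then f x else 0)"
      by (intro recursive_if recursive_pred_eq recursive_id recursive_const Suc)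
    moreover have "(\<lambda>x. if x < Suc n then f x else 0) =
        (\<lambda>x. if x = n then f n else if x < n then f x else 0)"
      by auto
    ultimately show ?case by simp
  qed
  moreover have "(\<lambda>x. if x < b then f x else 0) = f"
    by (intro ext) (use b in force)
  ultimately show ?thesis by metis
qed

section \<open>Bounded simulation of programs\<close>

text \<open>
  The bound \<open>s\<close> only limits the searches of \<open>Mu\<close>; the result \<open>0\<close> means that no value was found,
  and \<open>Suc y\<close> that the value is \<open>y\<close>.
\<close>

fun simulate :: "program \<Rightarrow> nat \<Rightarrow> nat set \<Rightarrow> nat list \<Rightarrow> nat" where
  "simulate Zero s X xs = 1"
| "simulate Succ s X xs = (if length xs = 1 then Suc (Suc (hd xs)) else 0)"
| "simulate (Proj i) s X xs = (if i < length xs then Suc (xs ! i) else 0)"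
| "simulate Query s X xs = (if length xs = 1 then Suc (of_bool (hd xs \<in> X)) else 0)"
| "simulate (Comp f gs) s X xs =
    (if 0 \<in> set (map (\<lambda>g. simulate g s X xs) gs) then 0
     else simulate f s X (map (\<lambda>g. simulate g s X xs - 1) gs))"
| "simulate (PrimRec f g) s X xs =
    (if xs = [] then 0
     else rec_nat (simulate f s X (tl xs))
       (\<lambda>i v. if v = 0 then 0 else simulate g s X (i # (v - 1) # tl xs)) (hd xs))"
| "simulate (Mu f) s X xs =
    (let n = LEAST n. s \<le> n \<or> simulate f s X (n # xs) \<le> 1
     in if n < s \<and> simulate f s X (n # xs) = 1 then Suc n else 0)"

lemma simulate_PrimRec_Cons:
  "simulate (PrimRec f g) s X (n # xs) = rec_nat (simulate f s X xs)
     (\<lambda>i v. if v = 0 then 0 else simulate g s X (i # (v - 1) # xs)) n"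
  by (simp only: simulate.simps list.sel list.simps if_False)

lemma simulate_sound: "simulate p s X xs = Suc y \<Longrightarrow> \<exists>Q. computes X p xs y Q"
proof (induction p arbitrary: xs y)
  case (Comp f gs)
  let ?ys = "map (\<lambda>g. simulate g s X xs - 1) gs"
  have nz: "simulate g s X xs \<noteq> 0" if "g \<in> set gs" for g
    using Comp.prems that by (auto split: if_splits)
  then have "\<exists>Q. computes X (gs ! i) xs (?ys ! i) Q" if "i < length gs" for i
    using Comp.IH(2)[of "gs ! i" xs "?ys ! i"] that by simp
  then obtain Qs where "\<forall>i<length gs. computes X (gs ! i) xs (?ys ! i) (Qs i)"
    by metis
  moreover obtain Q where "computes X f ?ys y Q"
    using Comp.prems Comp.IH(1) by (auto split: if_splits)
  ultimately show ?case by (blast intro: computes.comp[where ys = ?ys] length_map)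
next
  case (PrimRec f g)
  obtain n zs where xs: "xs = n # zs" using PrimRec.prems by (cases xs) auto
  let ?r = "rec_nat (simulate f s X zs)
      (\<lambda>i v. if v = 0 then 0 else simulate g s X (i # (v - 1) # zs))"
  have "\<exists>Q. computes X (PrimRec f g) (k # zs) y Q" if "?r k = Suc y" for k y
    using that
  proof (induction k arbitrary: y)
    case 0
    then obtain Q where "computes X f zs y Q" using PrimRec.IH(1) by auto
    then show ?case by (blast intro: computes.primrec_0)
  next
    case (Suc k)
    then obtain v where v: "?r k = Suc v" by (cases "?r k") auto
    then have "simulate g s X (k # v # zs) = Suc y" using Suc.prems by simp
    then show ?case using Suc.IH[OF v] PrimRec.IH(2) by (blast intro: computes.primrec_Suc)
  qed
  then show ?case using PrimRec.prems xs by (simp add: simulate_PrimRec_Cons del: simulate.simps)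
next
  case (Mu f)
  let ?n = "LEAST n. s \<le> n \<or> simulate f s X (n # xs) \<le> 1"
  have n: "?n = y" "y < s" "simulate f s X (y # xs) = Suc 0"
    using Mu.prems by (auto simp: Let_def split: if_splits)
  have "\<exists>v Q. computes X f (m # xs) (Suc v) Q" if "m < y" for m
  proof -
    have "\<not> simulate f s X (m # xs) \<le> 1" using that not_less_Least[of m] n(1) by blast
    then obtain v where "simulate f s X (m # xs) = Suc (Suc v)"
      by (metis One_nat_def not_less_eq_eq le_refl not0_implies_Suc zero_le)
    then show ?thesis using Mu.IH by blast
  qed
  then obtain v Qs where "\<forall>m<y. computes X f (m # xs) (Suc (v m)) (Qs m)" by metis
  moreover obtain Q where "computes X f (y # xs) 0 Q" using Mu.IH n(3) by blast
  ultimately show ?case by (blast intro: computes.mu)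
qed (auto simp: length_Suc_conv intro: computes.intros split: if_splits)

text \<open>A halting computation contains finitely many searches, so all large bounds serve all of
  them; the filter combines the bounds of the subcomputations.\<close>

lemma eventually_simulate:
  "computes X p xs y Q \<Longrightarrow> \<forall>\<^sub>F s in sequentially. simulate p s X xs = Suc y"
proof (induction rule: computes.induct)
  case (comp ys gs xs Qs f z Q)
  have "\<forall>\<^sub>F s in sequentially. \<forall>i\<in>{..<length gs}. simulate (gs ! i) s X xs = Suc (ys ! i)"
    using comp.IH(1) by (intro eventually_ball_finite) auto
  then show ?case using comp.IH(2)
  proof eventually_elim
    case (elim s)
    then have "map (\<lambda>g. simulate g s X xs) gs = map Suc ys"
      using comp.hyps(1) by (intro nth_equalityI) auto
    moreover from this have "map (\<lambda>g. simulate g s X xs - 1) gs = ys"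
      by (auto simp: list_eq_iff_nth_eq)
    moreover have "0 \<notin> set (map Suc ys)" by auto
    ultimately show ?case using elim by (simp del: set_map)
  qed
next
  case (primrec_Suc f g n xs y Q z R)
  from primrec_Suc.IH show ?case
    by eventually_elim (simp add: simulate_PrimRec_Cons del: simulate.simps)
next
  case (mu n f xs ys Qs Q)
  have "\<forall>\<^sub>F s in sequentially. \<forall>m\<in>{..<n}. simulate f s X (m # xs) = Suc (Suc (ys m))"
    using mu.IH(1) by (intro eventually_ball_finite) auto
  then show ?case using mu.IH(2) eventually_gt_at_top[of n]
  proof eventually_elim
    case (elim s)
    have "(LEAST n. s \<le> n \<or> simulate f s X (n # xs) \<le> 1) = n"
    proof (rule Least_equality)
      fix m assume m: "s \<le> m \<or> simulate f s X (m # xs) \<le> 1"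
      show "n \<le> m"
      proof (rule ccontr)
        assume "\<not> n \<le> m"
        then show False using m elim by auto
      qed
    qed (use elim in simp)
    then show ?case using elim by simp
  qed
qed auto

section \<open>Computability of the bounded simulation\<close>

lemma recursive_list_encode_Cons:
  assumes "recursive a" "recursive (\<lambda>z. list_encode (xs z))"
  shows "recursive (\<lambda>z. list_encode (a z # xs z))"
  unfolding list_encode.simps by (intro recursive_intros assms)

lemma recursive_list_encode_tl:
  assumes "recursive (\<lambda>z. list_encode (xs z))"
  shows "recursive (\<lambda>z. list_encode (tl (xs z)))"
proof -
  \<comment> \<open>The empty list has code 0 and truncated subtraction keeps it there, so the
    formula below also covers \<open>tl [] = []\<close>.\<close>
  have "prod_decode 0 = (0, 0)" by (simp add: prod_decode_def prod_decode_aux.simps)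
  then have *: "list_encode (tl ys) = psnd (list_encode ys - 1)" for ys by (cases ys) auto
  show ?thesis unfolding * by (intro recursive_intros assms)
qed

lemma recursive_list_encode_hd:
  assumes "recursive (\<lambda>z. list_encode (xs z))"
  shows "recursive (\<lambda>z. if xs z = [] then 0 else hd (xs z))"
proof -
  have *: "(if ys = [] then 0 else hd ys) = (if list_encode ys = 0 then 0 else pfst (list_encode ys - 1))"
    for ys by (cases ys) auto
  show ?thesis unfolding * by (intro recursive_intros assms)
qed

lemma recursive_pred_Nil:
  assumes "recursive (\<lambda>z. list_encode (xs z))"
  shows "recursive_pred (\<lambda>z. xs z = [])"
proof -
  have *: "ys = [] \<longleftrightarrow> list_encode ys = 0" for ys by (cases ys) auto
  show ?thesis unfolding * by (intro recursive_intros assms)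
qed

lemma recursive_pred_set_decode:
  assumes "recursive a" "recursive b" shows "recursive_pred (\<lambda>z. a z \<in> set_decode (b z))"
  unfolding set_decode_def mem_Collect_eq odd_iff_mod_2_eq_one
  by (intro recursive_intros assms)

text \<open>Induction on the fixed program takes the place of a universal machine: programs are
  never coded as inputs. Oracles are finite and given by canonical indices, so that they can be
  computed with.\<close>

lemma recursive_simulate:
  assumes "recursive s" "recursive b" "recursive (\<lambda>z. list_encode (xs z))"
  shows "recursive (\<lambda>z. simulate p (s z) (set_decode (b z)) (xs z))"
  using assms
proof (induction p arbitrary: s b xs)
  case Zero
  then show ?case by (simp add: recursive_const)
next
  case Succ
  have *: "simulate Succ s X ys =
      (if ys = [] then 0 else if tl ys = [] then Suc (Suc (if ys = [] then 0 else hd ys)) else 0)"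
    for s X ys by (cases ys) auto
  show ?case unfolding *
    by (intro recursive_intros recursive_pred_Nil recursive_list_encode_tl
        recursive_list_encode_hd Succ)
next
  case (Proj i)
  have *: "simulate (Proj i) s X ys =
      (if drop i ys = [] then 0 else Suc (if drop i ys = [] then 0 else hd (drop i ys)))"
    for s X ys by (auto simp: hd_drop_conv_nth)
  have "recursive (\<lambda>z. list_encode (drop i (xs z)))"
    using Proj(3)
  proof (induction i)
    case (Suc i)
    then have "recursive (\<lambda>z. list_encode (tl (drop i (xs z))))"
      by (intro recursive_list_encode_tl)
    then show ?case by (simp add: drop_Suc drop_tl)
  qed simp
  then show ?case unfolding *
    by (intro recursive_intros recursive_pred_Nil recursive_list_encode_hd)
next
  case Query
  have *: "simulate Query s X ys =
      (if ys = [] then 0 else if tl ys = []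
       then Suc (of_bool ((if ys = [] then 0 else hd ys) \<in> X)) else 0)"
    for s X ys by (cases ys) auto
  show ?case unfolding *
    by (intro recursive_intros recursive_pred_Nil recursive_list_encode_tl
        recursive_list_encode_hd recursive_pred_set_decode Query)
next
  case (Comp f gs)
  have "recursive_pred (\<lambda>z. 0 \<in> set (map (\<lambda>g. simulate g (s z) (set_decode (b z)) (xs z)) hs)) \<and>
      recursive (\<lambda>z. list_encode (map (\<lambda>g. simulate g (s z) (set_decode (b z)) (xs z) - 1) hs))"
    if "set hs \<subseteq> set gs" for hs
    using that
  proof (induction hs)
    case Nil
    then show ?case by (simp add: recursive_const recursive_pred_const)
  next
    case (Cons h hs)
    have h: "recursive (\<lambda>z. simulate h (s z) (set_decode (b z)) (xs z))"
      using Cons.prems by (intro Comp.IH(2) Comp.prems) auto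
    show ?case using Cons.IH Cons.prems h unfolding list.map list.set insert_iff
      by (intro conjI recursive_pred_disj recursive_list_encode_Cons recursive_pred_eq
          recursive_const recursive_minus) auto
  qed
  from this[OF order_refl] show ?case unfolding simulate.simps
    by (intro recursive_if recursive_const Comp.IH(1) Comp.prems) auto
next
  case (PrimRec f g)
  have snd2: "recursive (\<lambda>z. h (psnd (psnd z)))" if "recursive h" for h :: "nat \<Rightarrow> nat"
    using that by (rule recursive_comp) (intro recursive_intros)
  note ps = PrimRec.prems
  have *: "simulate (PrimRec f g) (s z) (set_decode (b z)) (xs z) = (if xs z = [] then 0
     else rec_nat (simulate f (s z) (set_decode (b z)) (tl (xs z)))
       (\<lambda>i v. if v = 0 then 0
          else simulate g (s z) (set_decode (b z)) (i # (v - 1) # tl (xs z)))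
       (if xs z = [] then 0 else hd (xs z)))" for z
    by simp
  show ?case unfolding *
    by (intro recursive_if recursive_const recursive_pred_Nil recursive_rec_nat PrimRec.IH
        recursive_list_encode_Cons recursive_list_encode_hd recursive_list_encode_tl
        recursive_pred_eq recursive_minus recursive_pfst recursive_psnd recursive_id
        ps snd2[OF ps(1)] snd2[OF ps(2)] recursive_list_encode_tl[OF snd2[OF ps(3)]])
next
  case (Mu f)
  have snd1: "recursive (\<lambda>z. h (psnd z))" if "recursive h" for h :: "nat \<Rightarrow> nat"
    using that by (rule recursive_comp) (intro recursive_intros)
  note ps = Mu.prems
  define n where "n z = (LEAST n. s z \<le> n \<or> simulate f (s z) (set_decode (b z)) (n # xs z) \<le> 1)"
    for z
  have n: "recursive n" unfolding n_def
    by (rule recursive_Least, blast)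
      (intro recursive_pred_disj recursive_pred_le Mu.IH recursive_list_encode_Cons
        recursive_pfst recursive_id recursive_const snd1[OF ps(1)] snd1[OF ps(2)] snd1[OF ps(3)])
  have *: "simulate (Mu f) (s z) (set_decode (b z)) (xs z) =
      (if n z < s z \<and> simulate f (s z) (set_decode (b z)) (n z # xs z) = 1 then Suc (n z) else 0)"
    for z by (simp add: n_def Let_def)
  show ?case unfolding *
    by (intro recursive_intros Mu.IH recursive_list_encode_Cons n ps)
qed

section \<open>Strings and their codes\<close>

lemma nat_of_string_string_of_nat [simp]: "nat_of_string (string_of_nat n) = n"
  unfolding string_of_nat_def by (rule surj_f_inv_f[OF bij_is_surj[OF bij_nat_of_string]])

lemma string_of_nat_nat_of_string [simp]: "string_of_nat (nat_of_string \<sigma>) = \<sigma>"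
  unfolding string_of_nat_def by (rule inv_f_f[OF bij_is_inj[OF bij_nat_of_string]])

lemma nat_of_string_eq_iff: "nat_of_string \<sigma> = n \<longleftrightarrow> \<sigma> = string_of_nat n"
  by auto

lemma nat_of_string_Nil [simp]: "nat_of_string [] = 0"
  by (simp add: nat_of_string_def)

lemma nat_of_string_snoc [simp]:
  "nat_of_string (\<sigma> @ [b]) = 2 * nat_of_string \<sigma> + 1 + of_bool b"
  by (simp add: nat_of_string_def)

lemma nat_of_string_bounds:
  "2 ^ length \<sigma> \<le> nat_of_string \<sigma> + 1 \<and> nat_of_string \<sigma> + 1 < 2 ^ (length \<sigma> + 1)"
proof (induction \<sigma> rule: rev_induct)
  case (snoc b \<sigma>)
  then show ?case by (cases b) auto
qed simp

lemma nat_of_string_append: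
  "nat_of_string (\<sigma> @ \<rho>) + 1 + 2 ^ length \<rho> = (nat_of_string \<sigma> + 1) * 2 ^ length \<rho> + nat_of_string \<rho> + 1"
proof (induction \<rho> rule: rev_induct)
  case (snoc b \<rho>)
  have "nat_of_string (\<sigma> @ \<rho> @ [b]) = 2 * nat_of_string (\<sigma> @ \<rho>) + 1 + of_bool b"
    using nat_of_string_snoc[of "\<sigma> @ \<rho>" b] by simp
  then show ?case using snoc by simp
qed simp

definition string_length :: "nat \<Rightarrow> nat" where
  "string_length n = length (string_of_nat n)"

lemma string_length_nat_of_string [simp]: "string_length (nat_of_string \<sigma>) = length \<sigma>"
  by (simp add: string_length_def)

lemma string_length_bounds:
  "2 ^ string_length n \<le> n + 1" "n + 1 < 2 ^ (string_length n + 1)"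
  using nat_of_string_bounds[of "string_of_nat n"] by (auto simp: string_length_def)

lemma string_length_eqI:
  assumes "2 ^ l \<le> n + 1" "n + 1 < 2 ^ (l + 1)" shows "string_length n = l"
proof -
  have "(2::nat) ^ l < 2 ^ (string_length n + 1)" "(2::nat) ^ string_length n < 2 ^ (l + 1)"
    using assms string_length_bounds[of n] by linarith+
  then have "l < string_length n + 1" "string_length n < l + 1"
    by (simp_all only: power_less_imp_less_exp[of "2::nat"] one_less_numeral_iff semiring_norm)
  then show ?thesis by simp
qed

lemma string_length_le: "string_length n \<le> n"
proof -
  have "string_length n < 2 ^ string_length n" by (rule less_exp)
  then show ?thesis using string_length_bounds(1)[of n] by linarith
qed

lemma recursive_string_length:
  assumes "recursive a" shows "recursive (\<lambda>z. string_length (a z))"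
proof -
  have *: "(LEAST l. n + 1 < 2 ^ (l + 1)) = string_length n" for n :: nat
  proof (rule Least_equality)
    fix l assume "n + 1 < 2 ^ (l + 1)"
    then have "(2::nat) ^ string_length n < 2 ^ (l + 1)"
      using string_length_bounds(1)[of n] by linarith
    then have "string_length n < l + 1"
      by (rule power_less_imp_less_exp[rotated]) simp
    then show "string_length n \<le> l" by simp
  qed (rule string_length_bounds)
  have "recursive (\<lambda>n. LEAST l. n + 1 < 2 ^ (l + 1))"
    by (rule recursive_Least, rule exI, rule string_length_bounds) (intro recursive_intros)
  then have "recursive string_length" unfolding * .
  then show ?thesis using assms by (rule recursive_comp)
qed

text \<open>Deleting the first bit splits the set into two prefix-free sets of shorter strings, each
  contributing half of its own sum. The empty string can only occur alone.\<close>

lemma kraft_inequality: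
  assumes "finite D" "prefix_free D"
  shows "(\<Sum>\<tau>\<in>D. (1 / 2 :: real) ^ length \<tau>) \<le> 1"
proof -
  have "(\<Sum>\<tau>\<in>D. (1 / 2 :: real) ^ length \<tau>) \<le> 1"
    if "finite D" "prefix_free D" "\<forall>\<tau>\<in>D. length \<tau> \<le> l" for l
    using that
  proof (induction l arbitrary: D)
    case 0
    then have "\<forall>\<tau>\<in>D. \<tau> = []" by simp
    then consider "D = {}" | "D = {[]}" by fast
    then show ?case by cases simp_all
  next
    case (Suc l)
    show ?case
    proof (cases "[] \<in> D")
      case True
      have "\<tau> = []" if "\<tau> \<in> D" for \<tau>
        using Suc.prems(2) True that Nil_prefix[of \<tau>] unfolding prefix_free_def by metis
      with True have "D = {[]}" by auto
      then show ?thesis by simp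
    next
      case False
      define E where "E b = {\<tau>. b # \<tau> \<in> D}" for b
      have D: "D = (#) True ` E True \<union> (#) False ` E False"
      proof (intro equalityI subsetI)
        fix \<tau> assume "\<tau> \<in> D"
        with False show "\<tau> \<in> (#) True ` E True \<union> (#) False ` E False"
          by (cases \<tau>; cases "hd \<tau>") (auto simp: E_def)
      qed (auto simp: E_def)
      have fin: "finite (E b)" for b
        unfolding E_def using finite_vimageI[OF Suc.prems(1), of "(#) b"]
        by (simp add: vimage_def inj_on_def)
      have "prefix_free (E b)" "\<forall>\<tau>\<in>E b. length \<tau> \<le> l" for b
      proof -
        show "prefix_free (E b)"
          unfolding prefix_free_def
        proof (intro ballI impI)
          fix \<sigma> \<tau> assume "\<sigma> \<in> E b" "\<tau> \<in> E b" "prefix \<sigma> \<tau>"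
          then have "b # \<sigma> \<in> D" "b # \<tau> \<in> D" "prefix (b # \<sigma>) (b # \<tau>)" by (simp_all add: E_def)
          then have "b # \<sigma> = b # \<tau>" using Suc.prems(2) unfolding prefix_free_def by metis
          then show "\<sigma> = \<tau>" by simp
        qed
        show "\<forall>\<tau>\<in>E b. length \<tau> \<le> l" using Suc.prems(3) by (auto simp: E_def)
      qed
      then have le: "(\<Sum>\<tau>\<in>E b. (1 / 2 :: real) ^ length \<tau>) \<le> 1" for b
        using Suc.IH fin by blast
      have "(\<Sum>\<tau>\<in>D. (1 / 2 :: real) ^ length \<tau>) =
          (\<Sum>\<tau>\<in>E True. (1 / 2) ^ Suc (length \<tau>)) + (\<Sum>\<tau>\<in>E False. (1 / 2) ^ Suc (length \<tau>))"
        using fin by (subst D, subst sum.union_disjoint) (auto simp: sum.reindex)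
      also have "\<dots> = ((\<Sum>\<tau>\<in>E True. (1 / 2) ^ length \<tau>) + (\<Sum>\<tau>\<in>E False. (1 / 2) ^ length \<tau>)) / 2"
        by (simp add: sum_divide_distrib add_divide_distrib)
      finally show ?thesis using le[of True] le[of False] by simp
    qed
  qed
  from this[OF assms, of "Max (length ` D)"] show ?thesis using assms(1) by simp
qed

lemma prefix_free_subset: "prefix_free D \<Longrightarrow> E \<subseteq> D \<Longrightarrow> prefix_free E"
  unfolding prefix_free_def by blast

lemma summable_on_prefix_free:
  assumes "prefix_free D" shows "(\<lambda>\<tau>. (1 / 2 :: real) ^ length \<tau>) summable_on D"
proof (rule nonneg_bdd_above_summable_on)
  show "bdd_above (sum (\<lambda>\<tau>. (1 / 2 :: real) ^ length \<tau>) ` {F. F \<subseteq> D \<and> finite F})"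
    using kraft_inequality prefix_free_subset[OF assms] by (auto intro!: bdd_aboveI[of _ 1])
qed simp

lemma complexity_leI: "M \<tau> = Some \<sigma> \<Longrightarrow> complexity M \<sigma> \<le> enat (length \<tau>)"
  unfolding complexity_def by (intro INF_lower) simp

lemma complexity_leE:
  assumes "complexity M \<sigma> \<le> enat k"
  obtains \<tau> where "M \<tau> = Some \<sigma>" "length \<tau> \<le> k"
proof -
  have "\<exists>\<tau>. M \<tau> = Some \<sigma> \<and> length \<tau> \<le> k"
  proof (rule ccontr)
    assume "\<not> ?thesis"
    then have "enat (Suc k) \<le> complexity M \<sigma>"
      unfolding complexity_def by (intro INF_greatest) auto
    then show False using assms by (metis Suc_n_not_le_n enat_ord_simps(1) order.trans)
  qed
  then show ?thesis using that by blast
qed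

section \<open>Machines whose domain has recursive measure\<close>

text \<open>Weights of strings of length at most \<open>s\<close> are integers over the denominator
  \<open>2 ^ s\<close>; in this way partial sums are represented by functions on the natural
  numbers.\<close>

lemma two_power_diff_divide: "l \<le> s \<Longrightarrow> (2::real) ^ (s - l) / 2 ^ s = (1 / 2) ^ l"
  by (simp add: power_diff power_one_over)

text \<open>The partial sums can be compared effectively with the rational approximations of \<mu>,
  so a stage that is certified to be close is found by search.\<close>

lemma recursive_real_modulus:
  assumes "recursive_real \<mu>" and P: "recursive P"
    and lim: "\<And>\<epsilon>. \<epsilon> > 0 \<Longrightarrow> \<exists>s. \<mu> - real (P s) / 2 ^ s < \<epsilon>"
  shows "\<exists>t. recursive t \<and> (\<forall>k. \<mu> - real (P (t k)) / 2 ^ t k < (1 / 2) ^ k)"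
proof -
  from assms(1) obtain a b d where abd: "recursive a" "recursive b" "recursive d"
    and q: "\<And>n. \<bar>\<mu> - (real (a n) - real (b n)) / real (Suc (d n))\<bar> \<le> (1 / 2) ^ n"
    unfolding recursive_real_def by blast
  define q where "q n = (real (a n) - real (b n)) / real (Suc (d n))" for n
  \<comment> \<open>With d = 2^-(k+2) the right side is the partial sum plus 4d. As \<mu> is at most
    the left side, \<open>C\<close> certifies an error below 4d = 2^-k; a stage with error below d
    satisfies it, since the left side is at most \<mu> + 2d.\<close>
  define C where "C s k \<longleftrightarrow> q (k + 2) + (1 / 2) ^ (k + 2) < real (P s) / 2 ^ s + (1 / 2) ^ k" for s k
  have "\<exists>s. C s k" for k
  proof -
    have "(0::real) < (1 / 2) ^ (k + 2)" by simp
    from lim[OF this] obtain s where "\<mu> - real (P s) / 2 ^ s < (1 / 2) ^ (k + 2)" ..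
    moreover have "q (k + 2) \<le> \<mu> + (1 / 2) ^ (k + 2)" using q[of "k + 2"] unfolding q_def by linarith
    moreover have "(1 / 2 :: real) ^ k = 4 * (1 / 2) ^ (k + 2)" by simp
    moreover have "(0::real) < (1 / 2) ^ (k + 2)" by simp
    ultimately have "C s k" unfolding C_def by linarith
    then show ?thesis ..
  qed
  \<comment> \<open>Clearing denominators and moving negative terms across turns this into a
    comparison of natural numbers.\<close>
  moreover have C: "C s k \<longleftrightarrow> a (k + 2) * 2 ^ s * 2 ^ (k + 2) + Suc (d (k + 2)) * 2 ^ s <
      b (k + 2) * 2 ^ s * 2 ^ (k + 2) + P s * Suc (d (k + 2)) * 2 ^ (k + 2)
        + Suc (d (k + 2)) * 2 ^ s * 4" (is "_ \<longleftrightarrow> ?l < ?r") for s k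
  proof -
    define j where "j = k + 2"
    define x where "x = real (Suc (d j)) * 2 ^ s * 2 ^ j"
    have x: "x > 0" by (simp add: x_def)
    have k: "(1 / 2 :: real) ^ k = 4 / 2 ^ j" by (simp add: j_def power_add power_divide)
    have "C s k \<longleftrightarrow> (q j + (1 / 2) ^ j) * x < (real (P s) / 2 ^ s + (1 / 2) ^ k) * x"
      unfolding C_def j_def[symmetric] using x by simp
    also have "(q j + (1 / 2) ^ j) * x
        = (real (a j) - real (b j)) * 2 ^ s * 2 ^ j + real (Suc (d j)) * 2 ^ s"
      unfolding q_def x_def power_one_over by (simp add: field_simps del: of_nat_Suc)
    also have "(real (P s) / 2 ^ s + (1 / 2) ^ k) * x
        = real (P s) * real (Suc (d j)) * 2 ^ j + real (Suc (d j)) * 2 ^ s * 4"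
      unfolding k x_def by (simp add: field_simps del: of_nat_Suc)
    also have "(real (a j) - real (b j)) * 2 ^ s * 2 ^ j + real (Suc (d j)) * 2 ^ s
        < real (P s) * real (Suc (d j)) * 2 ^ j + real (Suc (d j)) * 2 ^ s * 4 \<longleftrightarrow>
        real (a j * 2 ^ s * 2 ^ j + Suc (d j) * 2 ^ s)
        < real (b j * 2 ^ s * 2 ^ j + P s * Suc (d j) * 2 ^ j + Suc (d j) * 2 ^ s * 4)"
      unfolding of_nat_add of_nat_mult of_nat_power of_nat_numeral left_diff_distrib by linarith
    finally show ?thesis unfolding of_nat_less_iff j_def .
  qed
  have "recursive_pred (\<lambda>z. C (pfst z) (psnd z))"
    unfolding C by (intro recursive_intros abd[THEN recursive_comp] P[THEN recursive_comp])
  ultimately have "recursive (\<lambda>k. LEAST s. C s k)" by (intro recursive_Least)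
  moreover have "\<mu> - real (P (LEAST s. C s k)) / 2 ^ (LEAST s. C s k) < (1 / 2) ^ k" for k
  proof -
    have "C (LEAST s. C s k) k" using \<open>\<And>k. \<exists>s. C s k\<close> by (rule LeastI_ex)
    then show ?thesis using q[of "k + 2"] unfolding C_def q_def by linarith
  qed
  ultimately show ?thesis by blast
qed

text \<open>Finite subsets avoid infinite sums and are the form in which tails get
  estimated.\<close>

definition tail_modulus :: "nat set \<Rightarrow> (nat \<Rightarrow> nat) \<Rightarrow> bool" where
  "tail_modulus S t \<longleftrightarrow> (\<forall>k F. finite F \<longrightarrow> F \<subseteq> {n \<in> S. t k \<le> n} \<longrightarrow>
     (\<Sum>n\<in>F. (1 / 2 :: real) ^ string_length n) \<le> (1 / 2) ^ k)"

text \<open>A string of length k missing from \<open>L (t k)\<close> is not in the domain: its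
  weight alone would exceed what is left of the measure. The same \<open>t\<close> bounds tails,
  because \<open>L (t k)\<close> contains only codes below \<open>t k\<close>.\<close>

theorem recursive_domain_measure:
  assumes M: "prefix_free_machine M" and \<mu>: "recursive_real (domain_measure M)"
  obtains D t where "recursive D" "recursive t"
    and "\<And>\<tau> \<sigma>. M \<tau> = Some \<sigma> \<longleftrightarrow> D (nat_of_string \<tau>) = Suc (nat_of_string \<sigma>)"
    and "tail_modulus {n. D n \<noteq> 0} t"
proof -
  obtain p where p: "oracle_free p"
    and Mp: "\<And>\<tau> \<sigma>. M \<tau> = Some \<sigma> \<longleftrightarrow> computes {} p [nat_of_string \<tau>] (nat_of_string \<sigma>) {}"
    using M unfolding prefix_free_machine_def partial_recursive_def by blast
  define E where "E s n = simulate p s {} [n]" for s n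
  define W where "W = {n. \<exists>y. computes {} p [n] y {}}"
  define w where "w n = (1 / 2 :: real) ^ string_length n" for n
  define L where "L s = {n. n < s \<and> E s n \<noteq> 0}" for s
  \<comment> \<open>The measure of \<open>L s\<close> over the denominator \<open>2 ^ s\<close>. A
    code below \<open>s\<close> has length at most \<open>s\<close>, so the subtraction in the
    exponent is exact.\<close>
  define P :: "nat \<Rightarrow> nat" where "P s = (\<Sum>n<s. of_bool (E s n \<noteq> 0) * 2 ^ (s - string_length n))" for s
  have W: "W = nat_of_string ` dom M"
  proof -
    have "n \<in> W \<longleftrightarrow> string_of_nat n \<in> dom M" for n
    proof -
      have "n \<in> W \<longleftrightarrow> (\<exists>\<sigma>. computes {} p [nat_of_string (string_of_nat n)] (nat_of_string \<sigma>) {})"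
        unfolding W_def mem_Collect_eq nat_of_string_string_of_nat
        using surjD[OF bij_is_surj[OF bij_nat_of_string]] by metis
      then show ?thesis unfolding Mp[symmetric] by (auto simp: domIff)
    qed
    then show ?thesis by (auto simp: image_iff domIff nat_of_string_eq_iff
          intro!: bexI[of _ "string_of_nat x" for x])
  qed
  have "(w has_sum domain_measure M) W"
  proof -
    have "((\<lambda>\<tau>. w (nat_of_string \<tau>)) has_sum domain_measure M) (dom M)"
      using M summable_on_prefix_free[of "dom M"]
      by (auto simp: w_def domain_measure_def prefix_free_machine_def)
    then show ?thesis unfolding W
      by (subst has_sum_reindex) (auto simp: comp_def inj_on_def nat_of_string_eq_iff)
  qed
  then have sum_le: "sum w F \<le> domain_measure M" if "finite F" "F \<subseteq> W" for F
    using finite_sum_le_has_sum[OF \<open>(w has_sum domain_measure M) W\<close> that(1) that(2)]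
    by (simp add: w_def)
  have sum_gt: "\<exists>F. finite F \<and> F \<subseteq> W \<and> domain_measure M - sum w F < \<epsilon>" if "\<epsilon> > 0" for \<epsilon>
  proof -
    from that have "\<epsilon> / 2 > 0" by simp
    from has_sum_finite_approximation[OF \<open>(w has_sum domain_measure M) W\<close> this]
    obtain F where "finite F" "F \<subseteq> W" "dist (sum w F) (domain_measure M) \<le> \<epsilon> / 2" by auto
    moreover from this have "domain_measure M - sum w F < \<epsilon>"
      using that unfolding dist_real_def by linarith
    ultimately show ?thesis by blast
  qed
  have E_sound: "computes {} p [n] y {}" if "E s n = Suc y" for s n y
  proof -
    from that have "simulate p s {} [n] = Suc y" by (simp add: E_def)
    from simulate_sound[OF this] obtain Q where "computes {} p [n] y Q" ..
    then show ?thesis using computes_oracle_free p by metis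
  qed
  have E_ev: "\<forall>\<^sub>F s in sequentially. E s n \<noteq> 0" if n: "n \<in> W" for n
  proof -
    obtain y where "computes {} p [n] y {}" using n by (auto simp: W_def)
    from eventually_simulate[OF this] show ?thesis
      by eventually_elim (simp add: E_def)
  qed
  have L: "finite (L s)" "L s \<subseteq> W" for s
  proof -
    show "finite (L s)" by (simp add: L_def)
    show "L s \<subseteq> W"
    proof
      fix n assume "n \<in> L s"
      then obtain y where "E s n = Suc y" unfolding L_def using not0_implies_Suc by blast
      then show "n \<in> W" using E_sound unfolding W_def by blast
    qed
  qed
  have P: "real (P s) / 2 ^ s = sum w (L s)" for s
  proof -
    have "real (P s) / 2 ^ s = (\<Sum>n<s. if E s n \<noteq> 0 then w n else 0)"
      unfolding P_def of_nat_sum sum_divide_distrib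
    proof (rule sum.cong)
      fix n assume "n \<in> {..<s}"
      then have "string_length n \<le> s" using string_length_le[of n] by simp
      then show "real (of_bool (E s n \<noteq> 0) * 2 ^ (s - string_length n)) / 2 ^ s =
          (if E s n \<noteq> 0 then w n else 0)"
        by (simp add: w_def two_power_diff_divide)
    qed simp
    also have "\<dots> = sum w (L s)"
      by (simp add: sum.If_cases L_def lessThan_def Int_def)
    finally show ?thesis .
  qed
  have rec_E: "recursive (\<lambda>z. E (s z) (n z))" if "recursive s" "recursive n" for s n
    unfolding E_def set_decode_zero[symmetric]
    by (intro recursive_simulate recursive_list_encode_Cons that) (simp_all add: recursive_const)
  have "\<exists>t. recursive t \<and> (\<forall>k. domain_measure M - real (P (t k)) / 2 ^ t k < (1 / 2) ^ k)"
  proof (rule recursive_real_modulus[OF \<mu>])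
    show "recursive P" unfolding P_def
      by (intro recursive_intros rec_E recursive_string_length)
    fix \<epsilon> :: real assume "\<epsilon> > 0"
    then obtain F where F: "finite F" "F \<subseteq> W" "domain_measure M - sum w F < \<epsilon>"
      using sum_gt by blast
    then have "\<forall>\<^sub>F s in sequentially. \<forall>n\<in>F. E s n \<noteq> 0 \<and> n < s"
      by (intro eventually_ball_finite ballI eventually_conj eventually_gt_at_top E_ev) blast+
    from eventually_happens'[OF sequentially_bot this]
    obtain s where "\<forall>n\<in>F. E s n \<noteq> 0 \<and> n < s" ..
    then have "sum w F \<le> sum w (L s)"
      by (intro sum_mono2 L) (auto simp: L_def w_def)
    then show "\<exists>s. domain_measure M - real (P s) / 2 ^ s < \<epsilon>"
      using F(3) P by (intro exI[of _ s]) simp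
  qed
  then obtain t where t: "recursive t" "\<And>k. domain_measure M - sum w (L (t k)) < (1 / 2) ^ k"
    unfolding P by blast
  define D where "D n = E (t (string_length n)) n" for n
  have D: "D n = Suc y \<longleftrightarrow> computes {} p [n] y {}" for n y
  proof
    assume y: "computes {} p [n] y {}"
    have "n \<in> L (t (string_length n))"
    proof (rule ccontr)
      assume "n \<notin> L (t (string_length n))"
      moreover have "sum w (insert n (L (t (string_length n)))) \<le> domain_measure M"
        using L y by (intro sum_le) (auto simp: W_def)
      ultimately show False using t(2)[of "string_length n"] L by (simp add: w_def)
    qed
    then obtain y' where "D n = Suc y'" unfolding D_def L_def using not0_implies_Suc by blast
    moreover from this have "computes {} p [n] y' {}" using E_sound by (simp add: D_def)
    ultimately show "D n = Suc y" using computes_deterministic y by blast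
  qed (simp add: D_def E_sound)
  show ?thesis
  proof (rule that)
    show "recursive D" unfolding D_def
      by (intro rec_E recursive_intros t(1)[THEN recursive_comp] recursive_string_length)
    show "recursive t" by fact
    show "M \<tau> = Some \<sigma> \<longleftrightarrow> D (nat_of_string \<tau>) = Suc (nat_of_string \<sigma>)" for \<tau> \<sigma>
      unfolding D Mp ..
    show "tail_modulus {n. D n \<noteq> 0} t"
      unfolding tail_modulus_def
    proof (intro allI impI)
      fix k F assume F: "finite F" "F \<subseteq> {n \<in> {n. D n \<noteq> 0}. t k \<le> n}"
      have "F \<subseteq> W"
      proof
        fix n assume "n \<in> F"
        then obtain y where "D n = Suc y" using F(2) not0_implies_Suc by blast
        then show "n \<in> W" using D by (auto simp: W_def)
      qed
      then have "sum w (F \<union> L (t k)) \<le> domain_measure M" using F L by (intro sum_le) auto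
      moreover have "F \<inter> L (t k) = {}" using F(2) by (auto simp: L_def)
      ultimately have "sum w F + sum w (L (t k)) \<le> domain_measure M"
        using F(1) L by (simp add: sum.union_disjoint)
      then show "(\<Sum>n\<in>F. (1 / 2 :: real) ^ string_length n) \<le> (1 / 2) ^ k"
        using t(2)[of k] unfolding w_def by linarith
    qed
  qed
qed

section \<open>Machines from requests\<close>

text \<open>Evaluation is eager, so the program diverges wherever its search for \<open>n\<close>
  does; the equivalence in \<open>partial_recursive\<close> demands this direction too.\<close>

lemma partial_recursive_search:
  assumes C: "recursive_pred (\<lambda>z. C (pfst z) (psnd z))"
    and f: "recursive (\<lambda>z. f (pfst z) (psnd z))"
  shows "partial_recursive (\<lambda>\<tau>. let r = nat_of_string \<tau> in
    if \<exists>n. C n r then Some (string_of_nat (f (LEAST n. C n r) r)) else None)"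
proof -
  obtain pc where pc: "oracle_free pc"
    "\<And>z. computes {} pc [z] (of_bool (\<not> C (pfst z) (psnd z))) {}"
    using recursive_pred_not[OF C] by (auto simp: recursive_def recursive_pred_def)
  obtain pf where pf: "oracle_free pf"
    "\<And>z. computes {} pf [z] (f (pfst z) (psnd z)) {}"
    using f by (auto simp: recursive_def)
  let ?q = "Comp pc [pair_program]"
  let ?p = "Comp pf [Comp pair_program [Mu ?q, Proj 0]]"
  have q: "computes {} ?q [n, r] (of_bool (\<not> C n r)) {}" for n r
    using pc(2)[of "prod_encode (n, r)"] computes_pair[of n r]
    by (intro computes_comp[where ys = "[prod_encode (n, r)]"]) auto
  have p: "computes {} ?p [r] (f (LEAST n. C n r) r) {}" if "\<exists>n. C n r" for r
  proof -
    have "computes {} (Mu ?q) [r] (LEAST n. C n r) {}"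
      using that q by (rule Least_computes)
    then have "computes {} (Comp pair_program [Mu ?q, Proj 0]) [r] (prod_encode (LEAST n. C n r, r)) {}"
      by (intro computes_comp[where ys = "[LEAST n. C n r, r]"] computes_pair)
        (simp add: computes_proj)
    then show ?thesis using pf(2)[of "prod_encode (LEAST n. C n r, r)"]
      by (intro computes_comp[where ys = "[prod_encode (LEAST n. C n r, r)]"]) simp_all
  qed
  have ex: "\<exists>n. C n r" if "computes {} ?p [r] y {}" for r y
  proof -
    from that obtain n Q where "computes {} (Mu ?q) [r] n Q"
      by (elim Comp_E) (auto simp: less_Suc_eq all_conj_distrib elim!: Comp_E)
    then obtain Q' where "computes {} ?q [n, r] 0 Q'" by (auto elim: Mu_E)
    then have "of_bool (\<not> C n r) = (0::nat)" using computes_deterministic[OF q] by metis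
    then show ?thesis by (auto simp: of_bool_eq_0_iff)
  qed
  have "(let r = nat_of_string \<tau> in
      if \<exists>n. C n r then Some (string_of_nat (f (LEAST n. C n r) r)) else None) = Some \<sigma> \<longleftrightarrow>
      computes {} ?p [nat_of_string \<tau>] (nat_of_string \<sigma>) {}" for \<tau> \<sigma>
  proof (cases "\<exists>n. C n (nat_of_string \<tau>)")
    case True
    let ?y = "f (LEAST n. C n (nat_of_string \<tau>)) (nat_of_string \<tau>)"
    have "computes {} ?p [nat_of_string \<tau>] (nat_of_string \<sigma>) {} \<longleftrightarrow> ?y = nat_of_string \<sigma>"
      using p[OF True] computes_deterministic by metis
    also have "\<dots> \<longleftrightarrow> string_of_nat ?y = \<sigma>"
      by (metis nat_of_string_string_of_nat string_of_nat_nat_of_string)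
    finally show ?thesis using True by (simp only: Let_def if_True option.inject)
  next
    case False
    then have "\<not> computes {} ?p [nat_of_string \<tau>] (nat_of_string \<sigma>) {}" using ex by blast
    then show ?thesis using False by (simp only: Let_def if_False option.distinct simp_thms)
  qed
  moreover have "oracle_free ?p" using pc(1) pf(1) by simp
  ultimately show ?thesis unfolding partial_recursive_def by blast
qed

text \<open>As 1\<sigma> is the binary expansion of the code plus 1, these quotients are the
  endpoints of the dyadic interval of \<sigma>, translated by 1. Extending a string shrinks its
  interval.\<close>

lemma prefix_interval:
  assumes "prefix \<sigma> \<tau>"
  shows "(real (nat_of_string \<sigma>) + 1) / 2 ^ length \<sigma> \<le> (real (nat_of_string \<tau>) + 1) / 2 ^ length \<tau>"
    and "(real (nat_of_string \<tau>) + 2) / 2 ^ length \<tau> \<le> (real (nat_of_string \<sigma>) + 2) / 2 ^ length \<sigma>"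
proof -
  obtain \<rho> where \<tau>: "\<tau> = \<sigma> @ \<rho>" using assms by (auto simp: prefix_def)
  define a b r where "a = real (nat_of_string \<sigma>)" "b = real (nat_of_string \<rho>)" "r = (2::real) ^ length \<rho>"
  have "real (nat_of_string \<tau> + 1 + 2 ^ length \<rho>)
      = real ((nat_of_string \<sigma> + 1) * 2 ^ length \<rho> + nat_of_string \<rho> + 1)"
    unfolding \<tau> nat_of_string_append ..
  then have *: "real (nat_of_string \<tau>) = (a + 1) * r + b - r" by (simp add: a_b_r_def distrib_right)
  have "real (2 ^ length \<rho>) \<le> real (nat_of_string \<rho> + 1)"
    "real (nat_of_string \<rho> + 2) \<le> real (2 * 2 ^ length \<rho>)"
    using nat_of_string_bounds[of \<rho>] unfolding of_nat_le_iff by auto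
  then have b: "r \<le> b + 1" "b + 2 \<le> 2 * r" by (simp_all add: a_b_r_def)
  have len: "(2::real) ^ length \<tau> = 2 ^ length \<sigma> * r" by (simp add: \<tau> a_b_r_def power_add)
  have r: "r > 0" by (simp add: a_b_r_def)
  have 1: "x / 2 ^ length \<sigma> = x * r / 2 ^ length \<tau>" for x :: real
    unfolding len using r by simp
  show "(real (nat_of_string \<sigma>) + 1) / 2 ^ length \<sigma> \<le> (real (nat_of_string \<tau>) + 1) / 2 ^ length \<tau>"
    unfolding 1 * a_b_r_def(1)[symmetric]
    by (intro divide_right_mono) (use b in \<open>simp_all add: algebra_simps\<close>)
  show "(real (nat_of_string \<tau>) + 2) / 2 ^ length \<tau> \<le> (real (nat_of_string \<sigma>) + 2) / 2 ^ length \<sigma>"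
    unfolding 1 * a_b_r_def(1)[symmetric]
    by (intro divide_right_mono) (use b in \<open>simp_all add: algebra_simps\<close>)
qed

text \<open>
  Shannon--Fano--Elias coding: the \<open>m n\<close> requests with index \<open>n\<close> share the interval between the
  \<open>n\<close>-th and the next partial sum of the weights. It has \<open>2 * m n\<close> times the width of the intervals
  used as codewords, so after rounding its left end up there is still room for \<open>m n\<close> of them.
\<close>

theorem machine_from_requests:
  fixes l m t :: "nat \<Rightarrow> nat" and f :: "nat \<Rightarrow> nat \<Rightarrow> nat"
  assumes l: "recursive l" "\<And>n. l n \<le> n" and m: "recursive m"
    and f: "recursive (\<lambda>z. f (pfst z) (psnd z))"
    and V: "(\<lambda>n. real (m n) * (1 / 2) ^ l n) sums V"
    and t: "recursive t" "\<And>j. \<bar>V - (\<Sum>n<t j. real (m n) * (1 / 2) ^ l n)\<bar> \<le> (1 / 2) ^ j"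
  obtains N c where "prefix_free_machine N" "recursive_real (domain_measure N)"
    and "\<And>n x. x < m n \<Longrightarrow> complexity N (string_of_nat (f n x)) \<le> enat (l n + c)"
proof -
  define R where "R n = (\<Sum>i<n. real (m i) * (1 / 2) ^ l i)" for n
  \<comment> \<open>By \<open>l n \<le> n\<close>, the number \<open>2 ^ n\<close> is a common
    denominator of the first \<open>n\<close> weights.\<close>
  define U :: "nat \<Rightarrow> nat" where "U n = (\<Sum>i<n. m i * 2 ^ (n - l i))" for n
  have U: "real (U n) / 2 ^ n = R n" for n
    unfolding U_def R_def of_nat_sum sum_divide_distrib
  proof (rule sum.cong)
    fix i assume "i \<in> {..<n}"
    then have "l i \<le> n" using l(2)[of i] by simp
    then show "real (m i * 2 ^ (n - l i)) / 2 ^ n = real (m i) * (1 / 2) ^ l i"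
      using two_power_diff_divide[of "l i" n]
      by (simp only: of_nat_mult of_nat_power of_nat_numeral times_divide_eq_right[symmetric])
  qed simp
  have R_Suc: "R (Suc n) = R n + real (m n) * (1 / 2) ^ l n" for n by (simp add: R_def)
  have R_mono: "R n \<le> R n'" if "n \<le> n'" for n n'
    unfolding R_def using that by (intro sum_mono2) auto
  have R_le: "R n \<le> V" for n
    using sum_le_suminf[OF sums_summable[OF V], of "{..<n}"] sums_unique[OF V]
    by (simp add: R_def)
  \<comment> \<open>The total weight may exceed 1. Scaling by 2^-c fits it into the unit interval
    and lengthens every codeword by \<open>c\<close>.\<close>
  obtain c where c: "V \<le> 2 ^ c"
    using real_arch_pow[of 2 V] by (auto intro: less_imp_le)
  \<comment> \<open>This is \<open>R n * 2 ^ (l n + 1)\<close> rounded up: the left end of the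
    scaled interval in units of the codeword width \<open>1 / 2 ^ len n\<close>.\<close>
  define start where "start n = (U n * 2 ^ (l n + 1) + (2 ^ n - 1)) div 2 ^ n" for n
  define len where "len n = l n + 1 + c" for n
  have start: "R n * 2 ^ (l n + 1) \<le> real (start n)" "real (start n) < R n * 2 ^ (l n + 1) + 1" for n
  proof -
    define X where "X = U n * 2 ^ (l n + 1)"
    define P :: nat where "P = 2 ^ n"
    have P: "P > 0" by (simp add: P_def)
    have s: "start n = (X + (P - 1)) div P" by (simp add: start_def X_def P_def)
    have eq: "(X + (P - 1)) div P * P + (X + (P - 1)) mod P = X + (P - 1)" by simp
    have "(X + (P - 1)) mod P < P" using P by simp
    then have "X \<le> start n * P" "start n * P < X + P" using eq P unfolding s by linarith+
    then have "real X \<le> real (start n) * real P" "real (start n) * real P < real X + real P"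
      by (metis of_nat_le_iff of_nat_mult, metis of_nat_less_iff of_nat_mult of_nat_add)
    moreover have "real X = R n * 2 ^ (l n + 1) * real P"
      unfolding U[symmetric] X_def P_def by simp
    ultimately have "R n * 2 ^ (l n + 1) * real P \<le> real (start n) * real P"
      "real (start n) * real P < (R n * 2 ^ (l n + 1) + 1) * real P"
      by (simp_all only: distrib_right mult_1)
    then show "R n * 2 ^ (l n + 1) \<le> real (start n)" "real (start n) < R n * 2 ^ (l n + 1) + 1"
      using P by simp_all
  qed
  \<comment> \<open>A string of length \<open>len n\<close> with binary value v has the code
    \<open>2 ^ len n - 1 + v\<close>.\<close>
  define key where "key n x = 2 ^ len n - 1 + start n + x" for n x
  define C where "C n r \<longleftrightarrow> string_length r = len n \<and> start n + 2 ^ len n \<le> r + 1 \<and>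
      r + 1 < start n + 2 ^ len n + m n" for n r
  define g where "g n r = f n (r + 1 - (2 ^ len n + start n))" for n r
  define N where "N = (\<lambda>\<tau>. let r = nat_of_string \<tau> in
    if \<exists>n. C n r then Some (string_of_nat (g (LEAST n. C n r) r)) else None)"
  \<comment> \<open>Rounding up costs less than one unit, so the right end of codeword
    \<open>x\<close> is less than x + 2 units past the left end of the interval, and x + 2 \<le> 2 *
    \<open>m n\<close>.\<close>
  have bound: "real (start n + x) + 1 \<le> R (Suc n) * 2 ^ (l n + 1)" if "x < m n" for n x
  proof -
    have "real (start n + x) + 1 < R n * 2 ^ (l n + 1) + 1 + real x + 1" using start(2)[of n] by simp
    also have "\<dots> \<le> R n * 2 ^ (l n + 1) + 2 * real (m n)" using that by linarith
    also have "\<dots> = R (Suc n) * 2 ^ (l n + 1)"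
      unfolding R_Suc by (simp add: distrib_right power_one_over)
    finally show ?thesis by simp
  qed
  have two_len: "(2::real) ^ len n = 2 ^ (l n + 1) * 2 ^ c" for n
    by (simp add: len_def power_add)
  have key_Suc: "key n x + 1 = 2 ^ len n + start n + x" for n x by (simp add: key_def)
  have key_length: "string_length (key n x) = len n" if "x < m n" for n x
  proof (rule string_length_eqI)
    have "real (start n + x) + 1 \<le> R (Suc n) * 2 ^ (l n + 1)" using that by (rule bound)
    also have "\<dots> \<le> 2 ^ c * 2 ^ (l n + 1)"
      using R_le[of "Suc n"] c by (intro mult_right_mono) auto
    also have "\<dots> = real (2 ^ len n)" by (simp only: two_len mult.commute of_nat_power of_nat_numeral)
    finally have "start n + x + 1 \<le> 2 ^ len n"
      by (metis of_nat_1 of_nat_add of_nat_le_iff)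
    then show "key n x + 1 < 2 ^ (len n + 1)" unfolding key_Suc by simp
  qed (simp add: key_def)
  have C_key: "C n (key n x)" if "x < m n" for n x
    using that key_length[OF that] key_Suc[of n x] unfolding C_def by simp
  have C_D: "\<exists>x<m n. r = key n x" if "C n r" for n r
  proof (intro exI conjI)
    let ?x = "r + 1 - (2 ^ len n + start n)"
    show "?x < m n" using that unfolding C_def by linarith
    have "r + 1 = key n ?x + 1" using that unfolding key_Suc C_def by linarith
    then show "r = key n ?x" by simp
  qed
  have interval: "R n / 2 ^ c + 1 \<le> (real r + 1) / 2 ^ string_length r"
    "(real r + 2) / 2 ^ string_length r \<le> R (Suc n) / 2 ^ c + 1" if Cr: "C n r" for n r
  proof -
    obtain x where x: "x < m n" "r = key n x" using C_D[OF Cr] by blast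
    have "real (r + 1) = real (2 ^ len n + start n + x)" unfolding x(2) key_Suc ..
    then have r: "real r + 1 = 2 ^ len n + real (start n + x)" by simp
    have L: "string_length r = len n" using Cr by (simp add: C_def)
    have pos: "(0::real) < 2 ^ len n" by simp
    have "(R n / 2 ^ c + 1) * 2 ^ len n = R n * 2 ^ (l n + 1) + 2 ^ len n"
      by (simp add: two_len distrib_right)
    also have "\<dots> \<le> real r + 1" unfolding r using start(1)[of n] by simp
    finally show "R n / 2 ^ c + 1 \<le> (real r + 1) / 2 ^ string_length r"
      unfolding L using pos by (simp only: pos_le_divide_eq)
    have "real r + 2 \<le> R (Suc n) * 2 ^ (l n + 1) + 2 ^ len n"
      using bound[OF x(1)] r by linarith
    also have "\<dots> = (R (Suc n) / 2 ^ c + 1) * 2 ^ len n"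
      by (simp add: two_len distrib_right)
    finally show "(real r + 2) / 2 ^ string_length r \<le> R (Suc n) / 2 ^ c + 1"
      unfolding L using pos by (simp only: pos_divide_le_eq)
  qed
  \<comment> \<open>Intervals for different indices do not overlap, so comparable codewords share
    the index and hence the length.\<close>
  have prefix_eq: "n = n' \<and> \<sigma> = \<tau>"
    if "C n (nat_of_string \<sigma>)" "C n' (nat_of_string \<tau>)" "prefix \<sigma> \<tau>" for n n' \<sigma> \<tau>
  proof -
    note * = interval[OF that(1)] interval[OF that(2)] prefix_interval[OF that(3)]
    have lt: "(real r + 1) / 2 ^ k < (real r + 2) / 2 ^ k" for r k :: nat
      by (simp add: divide_strict_right_mono)
    have "\<not> n < n'"
    proof
      assume "n < n'"
      then have "R (Suc n) / 2 ^ c \<le> R n' / 2 ^ c" using R_mono by (simp add: divide_right_mono)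
      then show False using * lt[of "nat_of_string \<tau>" "length \<tau>"] by simp
    qed
    moreover have "\<not> n' < n"
    proof
      assume "n' < n"
      then have "R (Suc n') / 2 ^ c \<le> R n / 2 ^ c" using R_mono by (simp add: divide_right_mono)
      then show False using * lt[of "nat_of_string \<tau>" "length \<tau>"] by simp
    qed
    ultimately have "n = n'" by simp
    moreover from this have "length \<sigma> = length \<tau>" using that(1,2) by (simp add: C_def)
    ultimately show ?thesis using that(3) by (auto simp: prefix_def)
  qed
  have C_unique: "n = n'" if "C n r" "C n' r" for n n' r
    using prefix_eq[of n "string_of_nat r" n' "string_of_nat r"] that by simp
  have C_Least: "(LEAST n. C n r) = n" if "C n r" for n r
    using that C_unique by (metis LeastI)
  have N_key: "N (string_of_nat (key n x)) = Some (string_of_nat (f n x))" if "x < m n" for n x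
  proof -
    note * = C_key[OF that]
    have "g n (key n x) = f n x" unfolding g_def key_Suc by simp
    moreover have "\<exists>n'. C n' (key n x)" using * ..
    ultimately show ?thesis
      unfolding N_def nat_of_string_string_of_nat Let_def C_Least[OF *] by simp
  qed
  have dom: "dom N = (\<lambda>(n, x). string_of_nat (key n x)) ` (SIGMA n:UNIV. {..<m n})"
  proof (intro equalityI subsetI)
    fix \<tau> assume "\<tau> \<in> dom N"
    then obtain n where "C n (nat_of_string \<tau>)" by (auto simp: N_def Let_def split: if_splits)
    then obtain x where "x < m n" "nat_of_string \<tau> = key n x" using C_D by blast
    then show "\<tau> \<in> (\<lambda>(n, x). string_of_nat (key n x)) ` (SIGMA n:UNIV. {..<m n})"
      by (intro image_eqI[of _ _ "(n, x)"]) (simp_all add: nat_of_string_eq_iff)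
  qed (auto simp: N_key)
  have inj: "inj_on (\<lambda>(n, x). string_of_nat (key n x)) (SIGMA n:UNIV. {..<m n})"
  proof (rule inj_onI, clarify)
    fix n x n' x' assume x: "x < m n" "x' < m n'" "string_of_nat (key n x) = string_of_nat (key n' x')"
    then have k: "key n x = key n' x'" by (metis nat_of_string_string_of_nat)
    then have "n = n'" using C_key[OF x(1)] C_key[OF x(2)] C_unique by metis
    then show "n = n' \<and> x = x'" using k by (simp add: key_def)
  qed
  have pf: "prefix_free (dom N)"
    unfolding prefix_free_def
  proof (intro ballI impI)
    fix \<sigma> \<tau> assume "\<sigma> \<in> dom N" "\<tau> \<in> dom N" "prefix \<sigma> \<tau>"
    moreover from this obtain n n' where "C n (nat_of_string \<sigma>)" "C n' (nat_of_string \<tau>)"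
      by (auto simp: N_def Let_def split: if_splits)
    ultimately show "\<sigma> = \<tau>" using prefix_eq by blast
  qed
  have rec_pow: "recursive (\<lambda>z. 2 ^ len (a z))" if "recursive a" for a
    unfolding len_def using that by (intro recursive_intros l(1)[THEN recursive_comp])
  have rec_U: "recursive (\<lambda>z. U (a z))" if "recursive a" for a
  proof (rule recursive_comp[of U, OF _ that])
    show "recursive U" unfolding U_def
      by (intro recursive_intros l(1)[THEN recursive_comp] m[THEN recursive_comp])
  qed
  have rec_start: "recursive (\<lambda>z. start (a z))" if "recursive a" for a
    unfolding start_def using that
    by (intro recursive_intros l(1)[THEN recursive_comp] rec_U)
  have machine: "prefix_free_machine N"
    unfolding prefix_free_machine_def
  proof
    show "partial_recursive N" unfolding N_def
    proof (rule partial_recursive_search)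
      show "recursive_pred (\<lambda>z. C (pfst z) (psnd z))"
        unfolding C_def len_def
        by (intro recursive_intros recursive_string_length rec_start l(1)[THEN recursive_comp]
            m[THEN recursive_comp])
      have "recursive (\<lambda>z. prod_encode
          (pfst z, psnd z + 1 - (2 ^ len (pfst z) + start (pfst z))))"
        by (intro recursive_intros rec_start rec_pow)
      from recursive_comp[OF f this] show "recursive (\<lambda>z. g (pfst z) (psnd z))"
        by (simp add: g_def)
    qed
  qed (rule pf)
  have "((\<lambda>\<tau>. (1 / 2 :: real) ^ length \<tau>) has_sum V / 2 ^ (c + 1)) (dom N)"
  proof -
    define h where "h = (\<lambda>(n, x::nat). (1 / 2 :: real) ^ len n)"
    have eq: "h z = ((\<lambda>\<tau>. (1 / 2) ^ length \<tau>) \<circ> (\<lambda>(n, x). string_of_nat (key n x))) z"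
      if "z \<in> (SIGMA n:UNIV. {..<m n})" for z
      using that key_length by (auto simp: h_def string_length_def)
    have "h summable_on (SIGMA n:UNIV. {..<m n})"
      using summable_on_prefix_free[OF pf] unfolding dom summable_on_reindex[OF inj]
      by (subst summable_on_cong[OF eq])
    moreover have "((\<lambda>n. real (m n) * (1 / 2) ^ len n) has_sum V / 2 ^ (c + 1)) UNIV"
    proof -
      have "(\<lambda>n. real (m n) * (1 / 2) ^ l n / 2 ^ (c + 1)) sums (V / 2 ^ (c + 1))"
        using V by (rule sums_divide)
      moreover have "real (m n) * (1 / 2) ^ l n / 2 ^ (c + 1) = real (m n) * (1 / 2) ^ len n" for n
        by (simp add: len_def power_add power_one_over)
      ultimately have "(\<lambda>n. real (m n) * (1 / 2) ^ len n) sums (V / 2 ^ (c + 1))" by simp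
      then show ?thesis by (intro sums_nonneg_imp_has_sum) auto
    qed
    moreover have "((\<lambda>x. h (n, x)) has_sum real (m n) * (1 / 2) ^ len n) {..<m n}" for n
      using has_sum_finite[of "{..<m n}" "\<lambda>x. h (n, x)"] by (simp add: h_def)
    ultimately have "(h has_sum V / 2 ^ (c + 1)) (SIGMA n:UNIV. {..<m n})"
      by (intro has_sum_SigmaI[where g = "\<lambda>n. real (m n) * (1 / 2) ^ len n"])
    then show ?thesis unfolding dom has_sum_reindex[OF inj]
      by (subst (asm) has_sum_cong[OF eq])
  qed
  then have "domain_measure N = V / 2 ^ (c + 1)"
    unfolding domain_measure_def by (rule infsumI)
  moreover have "recursive_real (V / 2 ^ (c + 1))"
    unfolding recursive_real_def
  proof (intro exI conjI allI)
    show "recursive (\<lambda>j. U (t j))" by (intro rec_U t)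
    show "recursive (\<lambda>j. 0)" by (rule recursive_const)
    \<comment> \<open>The \<open>- 1\<close> is undone by the \<open>Suc\<close> in
      \<open>recursive_real\<close>.\<close>
    show "recursive (\<lambda>j. 2 ^ (t j + c + 1) - 1)" by (intro recursive_intros t)
    fix j
    have "real (Suc (2 ^ (t j + c + 1) - 1)) = 2 ^ t j * 2 ^ (c + 1)"
      by (simp add: power_add)
    then have "(real (U (t j)) - real 0) / real (Suc (2 ^ (t j + c + 1) - 1)) = R (t j) / 2 ^ (c + 1)"
      unfolding U[symmetric] by simp
    then have "\<bar>V / 2 ^ (c + 1) - (real (U (t j)) - real 0) / real (Suc (2 ^ (t j + c + 1) - 1))\<bar>
        = \<bar>V - R (t j)\<bar> / 2 ^ (c + 1)"
      by (simp only: diff_divide_distrib[symmetric] abs_divide power_abs abs_numeral)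
    also have "\<dots> \<le> \<bar>V - R (t j)\<bar> / 1"
    proof (rule divide_left_mono)
      show "(1::real) \<le> 2 ^ (c + 1)" by (rule one_le_power) simp
    qed simp_all
    also have "\<dots> \<le> (1 / 2) ^ j" using t(2)[of j] by (simp add: R_def)
    finally show "\<bar>V / 2 ^ (c + 1) - (real (U (t j)) - real 0) / real (Suc (2 ^ (t j + c + 1) - 1))\<bar>
      \<le> (1 / 2) ^ j" .
  qed
  ultimately have "recursive_real (domain_measure N)" by simp
  moreover have "complexity N (string_of_nat (f n x)) \<le> enat (l n + (c + 1))" if "x < m n" for n x
    using complexity_leI[of N, OF N_key[OF that]] key_length[OF that]
    by (simp add: string_length_def len_def)
  ultimately show ?thesis using machine that by blast
qed

section \<open>Tiny use implies Schnorr triviality\<close>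

lemma computes_finite: "computes X p xs y Q \<Longrightarrow> finite Q"
  by (induction rule: computes.induct) auto

text \<open>The use principle; it allows \<open>B\<close> to be replaced by its finite part below
  the use bound.\<close>

lemma computes_oracle_cong:
  "computes X p xs y Q \<Longrightarrow> X \<inter> Q = Y \<inter> Q \<Longrightarrow> computes Y p xs y Q"
proof (induction rule: computes.induct)
  case (query x)
  then have "of_bool (x \<in> X) = (of_bool (x \<in> Y) :: nat)" by auto
  then show ?case using computes.query[of Y x] by simp
next
  case (comp ys gs xs Qs f z Q)
  have "computes Y (gs ! i) xs (ys ! i) (Qs i)" if "i < length gs" for i
  proof -
    have "X \<inter> Qs i = Y \<inter> Qs i" using comp.prems that by blast
    then show ?thesis using comp.IH(1) that by blast
  qed
  moreover have "computes Y f ys z Q" using comp.prems by (intro comp.IH) blast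
  ultimately show ?case using comp.hyps(1) by (intro computes.comp) auto
next
  case (primrec_Suc f g n xs y Q z R)
  have "X \<inter> Q = Y \<inter> Q" "X \<inter> R = Y \<inter> R" using primrec_Suc.prems by blast+
  then show ?case using primrec_Suc.IH by (intro computes.primrec_Suc)
next
  case (mu n f xs ys Qs Q)
  have "computes Y f (m # xs) (Suc (ys m)) (Qs m)" if "m < n" for m
  proof -
    have "X \<inter> Qs m = Y \<inter> Qs m" using mu.prems that by blast
    then show ?thesis using mu.IH(1) that by blast
  qed
  moreover have "computes Y f (n # xs) 0 Q" using mu.prems by (intro mu.IH) blast
  ultimately show ?case by (intro computes.mu) auto
qed (auto intro: computes.intros)

lemma queries_eq: "computes B p [n] y Q \<Longrightarrow> queries B p n = Q"
  unfolding queries_def by (intro the_equality) (auto dest: computes_deterministic)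

text \<open>Absorbs the \<open>+ 1\<close> and the special value 0 of \<open>use_function\<close>;
  finiteness is what gives \<open>Max\<close> its meaning.\<close>

lemma use_function_le_iff:
  assumes "\<And>k. k < n \<Longrightarrow> finite (queries B p k)"
  shows "use_function B p n \<le> b \<longleftrightarrow> (\<Union>k<n. queries B p k) \<subseteq> {..<b}"
proof (cases "(\<Union>k<n. queries B p k) = {}")
  case False
  moreover have "finite (\<Union>k<n. queries B p k)" using assms by simp
  ultimately show ?thesis
    unfolding use_function_def Let_def by (simp only: if_False) (auto simp: Suc_le_eq)
qed (simp add: use_function_def)

lemma set_encode_less: "S \<subseteq> {..<n} \<Longrightarrow> set_encode S < 2 ^ n"
proof -
  assume "S \<subseteq> {..<n}"
  then have "set_encode S \<le> (\<Sum>i<n. 2 ^ i)"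
    unfolding set_encode_def by (intro sum_mono2) auto
  also have "\<dots> < (2::nat) ^ n" by (induction n) auto
  finally show ?thesis .
qed

lemma initial_segment_Suc: "initial_segment S (Suc n) = initial_segment S n @ [n \<in> S]"
  by (simp add: initial_segment_def)

text \<open>Each \<open>k\<close> satisfying \<open>P\<close> doubles the left side, which adds a
  power whose exponent counts the earlier such indices and so is at most \<open>k\<close>. A power
  of a counting function thus becomes a sum over thresholds, which can be interchanged with other
  sums.\<close>

lemma two_power_count_le:
  "(2::nat) ^ (\<Sum>k<n. of_bool (P k)) \<le> 1 + (\<Sum>k<n. of_bool (P k) * 2 ^ k)"
proof (induction n)
  case (Suc n)
  have "(\<Sum>k<n. of_bool (P k)) \<le> (\<Sum>k<n. 1::nat)" by (intro sum_mono) simp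
  then have "(\<Sum>k<n. of_bool (P k)) \<le> n" by simp
  then have "(2::nat) ^ (\<Sum>k<n. of_bool (P k)) \<le> 2 ^ n" by (intro power_increasing) auto
  then show ?case using Suc unfolding sum.lessThan_Suc
    by (cases "P n") (simp_all only: of_bool_eq power_add power_one_right mult_1 mult_0 add_0_right)
qed simp

text \<open>Totality on every oracle makes the search for a sufficient simulation bound succeed for
  every canonical index, also for oracles unrelated to the intended one.\<close>

lemma recursive_total_reduction:
  assumes "total_for_all_oracles p"
  obtains F where "recursive (\<lambda>z. F (pfst z) (psnd z))"
    and "\<And>x n y Q. computes (set_decode x) p [n] y Q \<Longrightarrow> F x n = y"
proof -
  define s where "s x n = (LEAST s. simulate p s (set_decode x) [n] \<noteq> 0)" for x n
  define F where "F x n = simulate p (s x n) (set_decode x) [n] - 1" for x n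
  have rec: "recursive (\<lambda>z. simulate p (a z) (set_decode (b z)) [c z])"
    if "recursive a" "recursive b" "recursive c" for a b c
    using that by (intro recursive_simulate recursive_list_encode_Cons) (simp_all add: recursive_const)
  have ex: "\<exists>s. simulate p s (set_decode x) [n] \<noteq> 0" for x n
  proof -
    obtain y Q where "computes (set_decode x) p [n] y Q"
      using assms unfolding total_for_all_oracles_def by metis
    from eventually_happens'[OF sequentially_bot eventually_simulate[OF this]]
    obtain s where "simulate p s (set_decode x) [n] = Suc y" ..
    then show ?thesis by (intro exI[of _ s]) simp
  qed
  have "recursive (\<lambda>z. s (pfst z) (psnd z))"
    unfolding s_def by (rule recursive_Least, rule ex) (intro recursive_intros rec)
  then have "recursive (\<lambda>z. F (pfst z) (psnd z))"
    unfolding F_def by (intro recursive_intros rec)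
  moreover have "F x n = y" if "computes (set_decode x) p [n] y Q" for x n y Q
  proof -
    have "simulate p (s x n) (set_decode x) [n] \<noteq> 0" unfolding s_def using ex by (rule LeastI_ex)
    then have "simulate p (s x n) (set_decode x) [n] = Suc (F x n)" by (simp add: F_def)
    from simulate_sound[OF this] show ?thesis using computes_deterministic that by blast
  qed
  ultimately show ?thesis by (rule that)
qed

text \<open>
  The function \<open>h\<close> counts the \<open>k\<close> with \<open>s k \<le> y\<close>, where \<open>s k\<close> exceeds all outputs of codes below
  \<open>t (4 * k)\<close>. So the factor \<open>2\<^sup>k\<close> only meets codes of total weight at most \<open>16\<^sup>-\<^sup>k\<close>.
\<close>

lemma slow_order:
  fixes D t :: "nat \<Rightarrow> nat"
  assumes D: "recursive D" and t: "recursive t"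
    and tail_modulus: "tail_modulus {n. D n \<noteq> 0} t"
  obtains h where "order_function h"
    and "\<And>j F. finite F \<Longrightarrow> F \<subseteq> {n. t (4 * j) \<le> n \<and> D n \<noteq> 0} \<Longrightarrow>
           (\<Sum>n\<in>F. 2 ^ h (D n - 1) * (1 / 2 :: real) ^ string_length n) \<le> 3 * (1 / 4) ^ j"
proof -
  have tail: "(\<Sum>n\<in>F. (1 / 2 :: real) ^ string_length n) \<le> (1 / 2) ^ k"
    if "finite F" "F \<subseteq> {n. t k \<le> n \<and> D n \<noteq> 0}" for k F
    using tail_modulus that unfolding tail_modulus_def by (elim allE impE) auto
  \<comment> \<open>The summand \<open>k\<close> ensures that every k with
    \<open>s k \<le> y\<close> is within the range of the sum defining \<open>h y\<close>.\<close>
  define s where "s k = k + (\<Sum>n<t (4 * k). D n)" for k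
  define h :: "nat \<Rightarrow> nat" where "h y = (\<Sum>k<Suc y. of_bool (s k \<le> y))" for y
  define w where "w n = (1 / 2 :: real) ^ string_length n" for n
  have "order_function h"
    unfolding order_function_def
  proof (intro conjI allI)
    have s: "recursive s" unfolding s_def
      by (intro recursive_intros t[THEN recursive_comp] D[THEN recursive_comp])
    show "recursive h" unfolding h_def
      by (intro recursive_intros s[THEN recursive_comp])
    show "mono h"
    proof (rule monoI)
      fix y y' :: nat assume "y \<le> y'"
      then have "h y \<le> (\<Sum>k<Suc y. of_bool (s k \<le> y'))"
        unfolding h_def by (intro sum_mono) auto
      also have "\<dots> \<le> h y'" unfolding h_def using \<open>y \<le> y'\<close> by (intro sum_mono2) auto
      finally show "h y \<le> h y'" .
    qed
    fix b
    define y where "y = b + (\<Sum>k<Suc b. s k)"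
    have "s k \<le> y" if "k < Suc b" for k
      using member_le_sum[of k "{..<Suc b}" s] that by (simp add: y_def)
    then have "(\<Sum>k<Suc b. 1) \<le> (\<Sum>k<Suc b. of_bool (s k \<le> y) :: nat)" by (intro sum_mono) auto
    also have "\<dots> \<le> h y" unfolding h_def by (intro sum_mono2) (auto simp: y_def)
    finally show "\<exists>n. b < h n" by (intro exI[of _ y]) simp
  qed
  moreover have "(\<Sum>n\<in>F. 2 ^ h (D n - 1) * w n) \<le> 3 * (1 / 4) ^ j"
    if F: "finite F" "F \<subseteq> {n. t (4 * j) \<le> n \<and> D n \<noteq> 0}" for j F
  proof -
    \<comment> \<open>A common range of \<open>k\<close> for all \<open>n\<close> in
      \<open>F\<close>, so that the two sums can be swapped.\<close>
    define K where "K = Suc (\<Sum>n\<in>F. D n)"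
    have pow: "2 ^ h (D n - 1) \<le> 1 + (\<Sum>k<K. of_bool (t (4 * k) \<le> n) * 2 ^ k :: real)"
      if n: "n \<in> F" for n
    proof -
      have Dn: "D n \<noteq> 0" "D n < K"
        using n F member_le_sum[of n F D] by (auto simp: K_def)
      \<comment> \<open>A code below \<open>t (4 * k)\<close> is counted in \<open>s k\<close> with
        the summand \<open>D n\<close>, one more than its output.\<close>
      have st: "t (4 * k) \<le> n" if "s k \<le> D n - 1" for k
      proof (rule ccontr)
        assume "\<not> t (4 * k) \<le> n"
        then have "D n \<le> (\<Sum>n<t (4 * k). D n)" by (intro member_le_sum) auto
        then show False using that Dn(1) by (simp add: s_def)
      qed
      have "2 ^ h (D n - 1) \<le> 1 + (\<Sum>k<Suc (D n - 1). of_bool (s k \<le> D n - 1) * 2 ^ k :: nat)"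
        unfolding h_def by (rule two_power_count_le)
      also have "\<dots> \<le> 1 + (\<Sum>k<Suc (D n - 1). of_bool (t (4 * k) \<le> n) * 2 ^ k)"
        using st by (intro add_left_mono sum_mono) auto
      also have "\<dots> \<le> 1 + (\<Sum>k<K. of_bool (t (4 * k) \<le> n) * 2 ^ k)"
        using Dn by (intro add_left_mono sum_mono2) auto
      finally have "real (2 ^ h (D n - 1)) \<le> real (1 + (\<Sum>k<K. of_bool (t (4 * k) \<le> n) * 2 ^ k))"
        by (simp only: of_nat_le_iff)
      then show ?thesis by simp
    qed
    have "(\<Sum>n\<in>F. 2 ^ h (D n - 1) * w n)
        \<le> (\<Sum>n\<in>F. (1 + (\<Sum>k<K. of_bool (t (4 * k) \<le> n) * 2 ^ k)) * w n)"
      using pow by (intro sum_mono mult_right_mono) (auto simp: w_def)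
    also have "\<dots> = sum w F + (\<Sum>n\<in>F. \<Sum>k<K. 2 ^ k * (of_bool (t (4 * k) \<le> n) * w n))"
      unfolding distrib_right mult_1 sum.distrib sum_distrib_right by (simp only: mult_ac)
    also have "(\<Sum>n\<in>F. \<Sum>k<K. 2 ^ k * (of_bool (t (4 * k) \<le> n) * w n))
        = (\<Sum>k<K. 2 ^ k * (\<Sum>n\<in>F. of_bool (t (4 * k) \<le> n) * w n))"
      unfolding sum_distrib_left by (rule sum.swap)
    also have "\<dots> \<le> (\<Sum>k<K. 2 ^ k * (1 / 4) ^ (j + k))"
    proof (intro sum_mono mult_left_mono)
      fix k
      have "(\<Sum>n\<in>F. of_bool (t (4 * k) \<le> n) * w n) = sum w {n \<in> F. t (4 * k) \<le> n}"
        unfolding sum.inter_filter[OF F(1)] by (rule sum.cong) auto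
      \<comment> \<open>These codes lie beyond both \<open>t (4 * j)\<close> and
        \<open>t (4 * k)\<close>, so the better tail bound applies. Its exponent is at least 2 * (j
        + k), which leaves decay in \<open>j\<close> and, even after the factor
        \<open>2 ^ k\<close>, in \<open>k\<close>.\<close>
      also have "\<dots> \<le> (1 / 2) ^ (4 * max j k)"
        using F by (cases "j \<le> k") (auto simp: w_def max_def intro!: tail)
      also have "\<dots> \<le> (1 / 2) ^ (2 * (j + k))" by (intro power_decreasing) auto
      also have "\<dots> = (1 / 4) ^ (j + k)" unfolding power_mult by (simp add: power2_eq_square)
      finally show "(\<Sum>n\<in>F. of_bool (t (4 * k) \<le> n) * w n) \<le> (1 / 4) ^ (j + k)" .
    qed simp
    also have "\<dots> = (1 / 4) ^ j * (\<Sum>k<K. (1 / 2) ^ k)"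
    proof -
      have "(2::real) ^ k * (1 / 4) ^ k = (1 / 2) ^ k" for k
        by (simp add: power_mult_distrib[symmetric])
      then have "(2::real) ^ k * (1 / 4) ^ (j + k) = (1 / 4) ^ j * (1 / 2) ^ k" for k
        by (simp add: power_add mult.left_commute)
      then show ?thesis by (simp add: sum_distrib_left)
    qed
    \<comment> \<open>Of the factor 3 in the claim, 2 comes from this geometric series and 1 from
      the constant term of \<open>pow\<close>.\<close>
    also have "\<dots> \<le> (1 / 4) ^ j * 2"
      by (intro mult_left_mono) (simp_all add: geometric_sum)
    also have "sum w F \<le> (1 / 2) ^ (4 * j)" unfolding w_def using F by (rule tail)
    also have "(1 / 2 :: real) ^ (4 * j) \<le> (1 / 2) ^ (2 * j)" by (intro power_decreasing) auto
    also have "(1 / 2 :: real) ^ (2 * j) = (1 / 4) ^ j"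
      unfolding power_mult by (simp add: power2_eq_square)
    finally show ?thesis by simp
  qed
  ultimately show ?thesis unfolding w_def by (rule that)
qed

lemma sums_tail_bound:
  fixes u :: "nat \<Rightarrow> real"
  assumes u: "\<And>n. 0 \<le> u n" and tail: "\<And>n. (\<Sum>i<n. u (i + T)) \<le> b"
  shows "summable u" "\<bar>suminf u - (\<Sum>n<T. u n)\<bar> \<le> b"
proof -
  have "summable (\<lambda>n. u (n + T))"
    using u tail by (intro summableI_nonneg_bounded) auto
  then show s: "summable u" by (simp only: summable_iff_shift)
  have "suminf u - (\<Sum>n<T. u n) = (\<Sum>n. u (n + T))"
    by (rule suminf_minus_initial_segment[OF s, symmetric])
  moreover have "(\<Sum>n. u (n + T)) \<le> b"
    using \<open>summable (\<lambda>n. u (n + T))\<close> tail by (rule suminf_le_const)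
  moreover have "0 \<le> (\<Sum>n. u (n + T))"
    using \<open>summable (\<lambda>n. u (n + T))\<close> u by (intro suminf_nonneg)
  ultimately show "\<bar>suminf u - (\<Sum>n<T. u n)\<bar> \<le> b" by simp
qed

text \<open>Requests are indexed by codes of descriptions rather than by the numbers described. Each
  description passes its own length on to all candidates, so a shortest one gives the bound.\<close>

theorem Schnorr_trivial_if_tt_tu_reducible:
  assumes AB: "A \<le>\<^sub>t\<^sub>t\<^sub>t\<^sub>u B"
  shows "Schnorr_trivial A"
  unfolding Schnorr_trivial_def
proof (intro allI impI, elim conjE)
  fix M assume M: "prefix_free_machine M" "recursive_real (domain_measure M)"
  obtain D t where D: "recursive D" and t: "recursive t"
    and MD: "\<And>\<tau> \<sigma>. M \<tau> = Some \<sigma> \<longleftrightarrow> D (nat_of_string \<tau>) = Suc (nat_of_string \<sigma>)"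
    and tail: "tail_modulus {n. D n \<noteq> 0} t"
    using recursive_domain_measure[OF M] by blast
  obtain h where h: "order_function h"
    and h_tail: "\<And>j F. finite F \<Longrightarrow> F \<subseteq> {n. t (4 * j) \<le> n \<and> D n \<noteq> 0} \<Longrightarrow>
           (\<Sum>n\<in>F. 2 ^ h (D n - 1) * (1 / 2 :: real) ^ string_length n) \<le> 3 * (1 / 4) ^ j"
    using slow_order[OF D t tail] by blast
  obtain p where p: "total_for_all_oracles p" "reduces p B A" "\<And>n. use_function B p n \<le> h n"
    using AB h unfolding tt_tu_reducible_def by blast
  obtain F where F: "recursive (\<lambda>z. F (pfst z) (psnd z))"
    and F_eq: "\<And>x n y Q. computes (set_decode x) p [n] y Q \<Longrightarrow> F x n = y"
    using recursive_total_reduction[OF p(1)] by blast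
  \<comment> \<open>The recursion is that of \<open>nat_of_string\<close>. For a wrong oracle
    \<open>F\<close> need not be 0-1-valued; \<open>g x n\<close> is then merely the code of a
    useless candidate.\<close>
  define g where "g x n = rec_nat 0 (\<lambda>i v. 2 * v + 1 + F x i) n" for x n
  have g: "\<exists>x<2 ^ h n. g x n = nat_of_string (initial_segment A n)" for n
  proof (intro exI conjI)
    let ?S = "B \<inter> {..<h n}"
    show "set_encode ?S < 2 ^ h n" by (rule set_encode_less) blast
    have "F (set_encode ?S) i = of_bool (i \<in> A)" if "i < n" for i
    proof -
      have run: "\<exists>Q. computes B p [k] (of_bool (k \<in> A)) Q" for k
        using p(2) by (simp add: reduces_def)
      then have "finite (queries B p k)" for k
        using queries_eq computes_finite by metis
      then have "(\<Union>k<n. queries B p k) \<subseteq> {..<h n}"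
        using p(3)[of n] use_function_le_iff by metis
      moreover obtain Q where Q: "computes B p [i] (of_bool (i \<in> A)) Q" using run by blast
      ultimately have "Q \<subseteq> {..<h n}" using queries_eq[OF Q] that by blast
      then have "computes ?S p [i] (of_bool (i \<in> A)) Q"
        by (intro computes_oracle_cong[OF Q]) blast
      moreover have "set_decode (set_encode ?S) = ?S" by (intro set_encode_inverse) simp
      ultimately show ?thesis using F_eq by metis
    qed
    then have "g (set_encode ?S) k = nat_of_string (initial_segment A k)" if "k \<le> n" for k
      using that
    proof (induction k)
      case 0
      then show ?case by (simp add: g_def initial_segment_def)
    next
      case (Suc k)
      then show ?case by (simp add: g_def initial_segment_Suc)
    qed
    then show "g (set_encode ?S) n = nat_of_string (initial_segment A n)" by simp
  qed
  define m :: "nat \<Rightarrow> nat" where "m n = (if D n = 0 then 0 else 2 ^ h (D n - 1))" for n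
  define f where "f n x = g x (D n - 1)" for n x
  define u where "u n = real (m n) * (1 / 2) ^ string_length n" for n
  have u_tail: "(\<Sum>i<n. u (i + t (4 * j))) \<le> 3 * (1 / 4) ^ j" for n j
  proof -
    let ?I = "{t (4 * j)..<n + t (4 * j)}"
    have "(\<Sum>i<n. u (i + t (4 * j))) = sum u ?I"
      using sum.shift_bounds_nat_ivl[of u 0 "t (4 * j)" n] by (simp add: atLeast0LessThan)
    also have "\<dots> = sum u {i \<in> ?I. D i \<noteq> 0}"
      by (rule sum.mono_neutral_right) (auto simp: u_def m_def)
    also have "\<dots> = (\<Sum>n\<in>{i \<in> ?I. D i \<noteq> 0}. 2 ^ h (D n - 1) * (1 / 2) ^ string_length n)"
      by (rule sum.cong) (auto simp: u_def m_def)
    also have "\<dots> \<le> 3 * (1 / 4) ^ j" by (rule h_tail) auto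
    finally show ?thesis .
  qed
  have u0: "0 \<le> u n" for n by (simp add: u_def)
  have V: "(\<lambda>n. real (m n) * (1 / 2) ^ string_length n) sums suminf u"
    using sums_tail_bound(1)[OF u0 u_tail] unfolding u_def by (rule summable_sums)
  \<comment> \<open>Passing to \<open>Suc j\<close> absorbs the factor 3.\<close>
  have modulus: "\<bar>suminf u - (\<Sum>n<t (4 * Suc j). real (m n) * (1 / 2) ^ string_length n)\<bar> \<le> (1 / 2) ^ j"
    for j
  proof -
    have "\<bar>suminf u - (\<Sum>n<t (4 * Suc j). u n)\<bar> \<le> 3 * (1 / 4) ^ Suc j"
      using sums_tail_bound(2)[OF u0 u_tail] .
    also have "\<dots> \<le> (1 / 4) ^ j" by simp
    also have "\<dots> \<le> (1 / 2) ^ j" by (intro power_mono) auto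
    finally show ?thesis unfolding u_def .
  qed
  have rec_h: "recursive h" using h by (simp add: order_function_def)
  obtain N c where N: "prefix_free_machine N" "recursive_real (domain_measure N)"
    and Nc: "\<And>n x. x < m n \<Longrightarrow> complexity N (string_of_nat (f n x)) \<le> enat (string_length n + c)"
  proof (rule machine_from_requests[OF _ string_length_le _ _ V _ modulus])
    show "recursive string_length" using recursive_string_length[OF recursive_id] .
    show "recursive m" unfolding m_def
      by (intro recursive_intros D[THEN recursive_comp] D rec_h[THEN recursive_comp])
    show "recursive (\<lambda>j. t (4 * Suc j))"
      by (intro recursive_intros t[THEN recursive_comp])
    show "recursive (\<lambda>z. f (pfst z) (psnd z))" unfolding f_def g_def
      by (intro recursive_rec_nat recursive_intros recursive_comp2[OF F] D[THEN recursive_comp])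
  qed blast
  show "\<exists>N c. prefix_free_machine N \<and> recursive_real (domain_measure N) \<and>
      (\<forall>n. complexity N (initial_segment A n) \<le> complexity M (string_of_nat n) + enat c)"
  proof (intro exI conjI allI)
    fix n
    show "complexity N (initial_segment A n) \<le> complexity M (string_of_nat n) + enat c"
    proof (cases "complexity M (string_of_nat n)")
      case (enat k)
      then obtain \<tau> where \<tau>: "M \<tau> = Some (string_of_nat n)" "length \<tau> \<le> k"
        using complexity_leE[of M "string_of_nat n" k] by auto
      then have Dn: "D (nat_of_string \<tau>) = Suc n" by (simp add: MD)
      obtain x where x: "x < 2 ^ h n" "g x n = nat_of_string (initial_segment A n)" using g by blast
      have "complexity N (string_of_nat (f (nat_of_string \<tau>) x)) \<le> enat (length \<tau> + c)"
        using Nc[of x "nat_of_string \<tau>"] x(1) Dn by (simp add: m_def)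
      also have "string_of_nat (f (nat_of_string \<tau>) x) = initial_segment A n"
        using x(2) Dn by (simp add: f_def)
      also have "enat (length \<tau> + c) \<le> enat k + enat c" using \<tau>(2) by simp
      finally show ?thesis using enat by simp
    qed simp
  qed (use N in auto)
qed

section \<open>Schnorr trivial sets are reducible with tiny use\<close>

lemma computes_comp1:
  assumes "computes X g xs y Q" "computes X f [y] z R"
  shows "computes X (Comp f [g]) xs z (Q \<union> R)"
proof -
  have "(\<Union>i<length [g]. Q) = Q" by auto
  then show ?thesis using computes.comp[of "[y]" "[g]" X xs "\<lambda>_. Q" f z R] assms by simp
qed

lemma computes_comp2:
  assumes "computes X g1 xs y1 Q1" "computes X g2 xs y2 Q2" "computes X f [y1, y2] z R"
  shows "computes X (Comp f [g1, g2]) xs z (Q1 \<union> Q2 \<union> R)"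
proof -
  have *: "{..<length [g1, g2]} = {0, 1}" by auto
  show ?thesis
    using computes.comp[of "[y1, y2]" "[g1, g2]" X xs "\<lambda>i. if i = 0 then Q1 else Q2" f z R] assms
    unfolding * by (simp add: less_Suc_eq all_conj_distrib Un_commute)
qed

text \<open>The queries depend on \<open>n\<close> alone and not on the answers, so such a program
  halts on every oracle and its use is explicit. On the intended oracle a single summand will
  survive.\<close>

lemma reduction_by_sum:
  assumes a: "recursive a" and b: "recursive b"
    and q: "recursive (\<lambda>z. q (pfst z) (psnd z))" and d: "recursive (\<lambda>z. d (pfst z) (psnd z))"
  obtains p where "\<And>X n. computes X p [n] (a n + (\<Sum>t<b n. of_bool (q t n \<in> X) * d t n))
      ((\<lambda>t. q t n) ` {..<b n})"
proof -
  have rel: "\<exists>p. \<forall>X n. computes X p [n] (f n) {}" if "recursive f" for f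
    using that computes_oracle_free unfolding recursive_def by blast
  obtain pa pb pq where pa: "\<And>X n. computes X pa [n] (a n) {}"
    and pb: "\<And>X n. computes X pb [n] (b n) {}"
    and pq: "\<And>X n. computes X pq [n] (q (pfst n) (psnd n)) {}"
    using rel[OF a] rel[OF b] rel[OF q] by blast
  have "recursive (\<lambda>z. pfst z + pfst (psnd z) * d (pfst (psnd (psnd z))) (psnd (psnd (psnd z))))"
    by (intro recursive_intros recursive_comp2[OF d])
  from rel[OF this] obtain ps where ps: "\<And>X n. computes X ps [n]
      (pfst n + pfst (psnd n) * d (pfst (psnd (psnd n))) (psnd (psnd (psnd n)))) {}"
    by blast
  have pair: "computes X pair_program [x, y] (prod_encode (x, y)) {}" for X x y
    using computes_oracle_free[OF computes_pair] by simp
  let ?tn = "Comp pair_program [Proj 0, Proj 2]"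
  let ?Q = "Comp Query [Comp pq [?tn]]"
  let ?G = "Comp ps [Comp pair_program [Proj 1, Comp pair_program [?Q, ?tn]]]"
  have G: "computes X ?G [t, v, n] (v + of_bool (q t n \<in> X) * d t n) {q t n}" for X t v n
  proof -
    have tn: "computes X ?tn [t, v, n] (prod_encode (t, n)) {}"
      using computes_comp2[OF _ _ pair, of X "Proj 0" "[t, v, n]" t "{}" "Proj 2" n "{}"]
        computes.proj[of 0 "[t, v, n]" X] computes.proj[of 2 "[t, v, n]" X] by simp
    have "computes X (Comp pq [?tn]) [t, v, n] (q t n) {}"
      using computes_comp1[OF tn pq] by simp
    from computes_comp1[OF this computes.query]
    have "computes X ?Q [t, v, n] (of_bool (q t n \<in> X)) {q t n}" by simp
    from computes_comp2[OF this tn pair]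
    have "computes X (Comp pair_program [?Q, ?tn]) [t, v, n]
        (prod_encode (of_bool (q t n \<in> X), prod_encode (t, n))) {q t n}" by simp
    from computes_comp2[OF computes.proj[of 1 "[t, v, n]"] this pair]
    have "computes X (Comp pair_program [Proj 1, Comp pair_program [?Q, ?tn]]) [t, v, n]
        (prod_encode (v, prod_encode (of_bool (q t n \<in> X), prod_encode (t, n)))) {q t n}" by simp
    from computes_comp1[OF this ps] show ?thesis by simp
  qed
  have "computes X (PrimRec pa ?G) [k, n] (a n + (\<Sum>t<k. of_bool (q t n \<in> X) * d t n))
      ((\<lambda>t. q t n) ` {..<k})" for X k n
  proof (induction k)
    case 0
    then show ?case using pa by (simp add: computes.primrec_0)
  next
    case (Suc k)
    have "(\<lambda>t. q t n) ` {..<Suc k} = (\<lambda>t. q t n) ` {..<k} \<union> {q k n}" by (auto simp: lessThan_Suc)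
    with computes.primrec_Suc[OF Suc G] show ?case by (simp only: sum.lessThan_Suc add.assoc)
  qed
  from computes_comp2[OF pb computes.proj[of 0] this]
  have "computes X (Comp (PrimRec pa ?G) [pb, Proj 0]) [n]
      (a n + (\<Sum>t<b n. of_bool (q t n \<in> X) * d t n)) ((\<lambda>t. q t n) ` {..<b n})" for X n
    by simp
  then show ?thesis by (rule that)
qed

text \<open>The code plus 1 has the binary expansion 1 followed by the bits of the segment, bit 0
  being the most significant of them.\<close>

lemma initial_segment_bit:
  "i < n \<Longrightarrow> (nat_of_string (initial_segment S n) + 1) div 2 ^ (n - 1 - i) mod 2 = of_bool (i \<in> S)"
proof (induction n)
  case (Suc n)
  define x where "x = nat_of_string (initial_segment S n) + 1"
  have x: "nat_of_string (initial_segment S (Suc n)) + 1 = 2 * x + of_bool (n \<in> S)"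
    by (simp add: initial_segment_Suc x_def)
  show ?case
  proof (cases "i = n")
    case False
    then have "i < n" using Suc.prems by simp
    then have "(2::nat) ^ (Suc n - 1 - i) = 2 * 2 ^ (n - 1 - i)"
      by (simp add: power_Suc[symmetric] Suc_diff_Suc)
    then have "(2 * x + of_bool (n \<in> S)) div 2 ^ (Suc n - 1 - i) = x div 2 ^ (n - 1 - i)"
      by (simp add: div_mult2_eq)
    then show ?thesis using Suc.IH \<open>i < n\<close> unfolding x by (simp add: x_def)
  next
    case True
    then show ?thesis unfolding x by (cases "n \<in> S") simp_all
  qed
qed simp

lemma prod_encode_mono: "a \<le> a' \<Longrightarrow> b \<le> b' \<Longrightarrow> prod_encode (a, b) \<le> prod_encode (a', b')"
  unfolding prod_encode_def prod.case by (intro add_mono monoD[OF triangle_mono]) auto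

text \<open>
  The oracle stores, for each \<open>k\<close>, the code \<open>T k\<close> of a description of \<open>A\<close> up to \<open>g k\<close>, where \<open>g\<close>
  grows so fast that the reduction may look at all possible codes. The column \<open>e\<close> is arbitrary, so
  that the codes for different order functions can be stored in a common oracle.
\<close>

lemma reduction_from_codes:
  assumes A: "Schnorr_trivial A" and h: "order_function h"
  shows "\<exists>T. \<forall>B e. (\<forall>k t. prod_encode (e, prod_encode (k, t)) \<in> B \<longleftrightarrow> t = T k) \<longrightarrow>
    (\<exists>p. total_for_all_oracles p \<and> reduces p B A \<and> (\<forall>n. use_function B p n \<le> h n))"
proof -
  have h': "recursive h" "mono h" "\<And>b. \<exists>n. b < h n" using h by (auto simp: order_function_def)
  \<comment> \<open>A strict bound on the queries to block \<open>k\<close>. Neither the column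
    \<open>e\<close> nor the constant \<open>c\<close> is known yet; the first \<open>k\<close>
    stands in for \<open>e\<close> and the exponent 2 * k + 1 for k + c + 1, which is right once
    \<open>k\<close> is at least \<open>e\<close> and \<open>c\<close>.\<close>
  define b where "b k = Suc (prod_encode (k, prod_encode (k, 2 ^ (2 * k + 1))))" for k
  \<comment> \<open>Block \<open>k\<close> + 1 is first consulted for bits from \<open>g k\<close>
    on, where \<open>h\<close> already permits all its queries; \<open>k \<le> x\<close> makes
    \<open>g\<close> unbounded.\<close>
  define g where "g k = (LEAST x. k \<le> x \<and> b (k + 1) \<le> h x)" for k
  have g_ex: "\<exists>x. k \<le> x \<and> b (k + 1) \<le> h x" for k
  proof -
    obtain x where "b (k + 1) < h x" using h'(3) by blast
    moreover have "h x \<le> h (max k x)" by (intro monoD[OF h'(2)]) simp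
    ultimately show ?thesis by (intro exI[of _ "max k x"]) simp
  qed
  have g: "k \<le> g k" "b (k + 1) \<le> h (g k)" for k
    using LeastI_ex[OF g_ex[of k]] unfolding g_def by auto
  have rec_g: "recursive g"
    unfolding g_def b_def
    by (rule recursive_Least, rule g_ex[unfolded b_def])
      (intro recursive_intros h'(1)[THEN recursive_comp])
  define K where "K n = (LEAST k. n < g k)" for n
  have K_ex: "\<exists>k. n < g k" for n
    using g(1)[of "Suc n"] by (intro exI[of _ "Suc n"]) simp
  have K: "n < g (K n)" for n unfolding K_def using K_ex by (rule LeastI_ex)
  have rec_K: "recursive K"
    unfolding K_def
    by (rule recursive_Least, rule K_ex) (intro recursive_intros rec_g[THEN recursive_comp])
  have modulus: "\<bar>2 - (\<Sum>n<Suc j. real 1 * (1 / 2) ^ n)\<bar> \<le> (1 / 2) ^ j" for j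
    by (simp add: geometric_sum del: sum.lessThan_Suc)
  obtain M c0 where M: "prefix_free_machine M" "recursive_real (domain_measure M)"
    and Mc: "\<And>n x. x < (1::nat) \<Longrightarrow> complexity M (string_of_nat (g n)) \<le> enat (n + c0)"
  proof (rule machine_from_requests[where l = "\<lambda>n. n" and m = "\<lambda>n. 1" and f = "\<lambda>n x. g n"
        and V = 2 and t = Suc])
    show "(\<lambda>n. real 1 * (1 / 2) ^ n) sums 2"
      using geometric_sums[of "1 / 2 :: real"] by simp
    show "\<bar>2 - (\<Sum>n<Suc j. real 1 * (1 / 2) ^ n)\<bar> \<le> (1 / 2) ^ j" for j by (rule modulus)
    show "recursive (\<lambda>z. g (pfst z))" by (intro recursive_intros rec_g[THEN recursive_comp])
    show "recursive Suc" using recursive_Suc[OF recursive_id] .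
    show "recursive (\<lambda>n. n)" by (rule recursive_id)
    show "recursive (\<lambda>n. 1)" by (rule recursive_const)
    show "n \<le> n" for n :: nat by simp
  qed blast
  obtain N c1 where N: "prefix_free_machine N" "recursive_real (domain_measure N)"
    and Nc: "\<And>n. complexity N (initial_segment A n) \<le> complexity M (string_of_nat n) + enat c1"
    using A[unfolded Schnorr_trivial_def, rule_format, OF conjI[OF M]] by auto
  obtain D t where D: "recursive D" and "recursive t"
    and ND: "\<And>\<tau> \<sigma>. N \<tau> = Some \<sigma> \<longleftrightarrow> D (nat_of_string \<tau>) = Suc (nat_of_string \<sigma>)"
    and "tail_modulus {n. D n \<noteq> 0} t"
    using recursive_domain_measure[OF N] by blast
  define c where "c = c0 + c1"
  have "\<exists>r. D r = Suc (nat_of_string (initial_segment A (g k))) \<and> r < 2 ^ (k + c + 1)" for k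
  proof -
    have "complexity N (initial_segment A (g k)) \<le> enat (k + c0) + enat c1"
      using order_trans[OF Nc[of "g k"] add_right_mono[OF Mc[of 0 k]]] by simp
    then obtain \<tau> where \<tau>: "N \<tau> = Some (initial_segment A (g k))" "length \<tau> \<le> k + c"
      using complexity_leE[of N "initial_segment A (g k)" "k + c"] by (auto simp: c_def add.assoc)
    have "nat_of_string \<tau> + 1 < 2 ^ (length \<tau> + 1)" using nat_of_string_bounds by blast
    also have "\<dots> \<le> 2 ^ (k + c + 1)" using \<tau>(2) by (intro power_increasing) auto
    finally show ?thesis using \<tau>(1) by (intro exI[of _ "nat_of_string \<tau>"]) (simp add: ND)
  qed
  then obtain T where T: "\<And>k. D (T k) = Suc (nat_of_string (initial_segment A (g k)))"
    "\<And>k. T k < 2 ^ (k + c + 1)"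
    by metis
  have "\<exists>p. total_for_all_oracles p \<and> reduces p B A \<and> (\<forall>n. use_function B p n \<le> h n)"
    if B: "\<forall>k t. prod_encode (e, prod_encode (k, t)) \<in> B \<longleftrightarrow> t = T k" for B e
  proof -
    \<comment> \<open>Below \<open>k0\<close> the bounds built into \<open>b\<close> may fail; this
      concerns finitely many bits, which \<open>a\<close> supplies. The \<open>Suc\<close> makes
      \<open>K n\<close> positive on all other bits, so that there is a preceding block.\<close>
    define k0 where "k0 = Suc (max c e)"
    define a :: "nat \<Rightarrow> nat" where "a n = of_bool (n \<in> A \<and> K n < k0)" for n
    define m :: "nat \<Rightarrow> nat" where "m n = (if K n < k0 then 0 else 2 ^ (2 * K n + 1))" for n
    define q where "q t n = prod_encode (e, prod_encode (K n, t))" for t n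
    \<comment> \<open>\<open>D t\<close> is the code of the output plus 1, the number whose binary
      digits \<open>initial_segment_bit\<close> reads off.\<close>
    define d where "d t n = D t div 2 ^ (g (K n) - 1 - n) mod 2" for t n
    have "recursive a"
    proof (rule recursive_finite_support)
      have "n < (\<Sum>k<k0. g k)" if "K n < k0" for n
        using K[of n] member_le_sum[of "K n" "{..<k0}" g] that by simp
      then have "{n. a n \<noteq> 0} \<subseteq> {..<\<Sum>k<k0. g k}" by (auto simp: a_def)
      then show "finite {n. a n \<noteq> 0}" by (rule finite_subset) simp
    qed
    moreover have "recursive m" unfolding m_def
      by (intro recursive_intros rec_K rec_K[THEN recursive_comp])
    moreover have "recursive (\<lambda>z. q (pfst z) (psnd z))" unfolding q_def
      by (intro recursive_intros rec_K[THEN recursive_comp])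
    moreover have "recursive (\<lambda>z. d (pfst z) (psnd z))" unfolding d_def
      by (intro recursive_intros D[THEN recursive_comp] rec_g[THEN recursive_comp]
          rec_K[THEN recursive_comp])
    ultimately obtain p where p: "\<And>X n. computes X p [n]
        (a n + (\<Sum>t<m n. of_bool (q t n \<in> X) * d t n)) ((\<lambda>t. q t n) ` {..<m n})"
      using reduction_by_sum[of a m q d] by blast
    have "a n + (\<Sum>t<m n. of_bool (q t n \<in> B) * d t n) = of_bool (n \<in> A)" for n
    proof (cases "K n < k0")
      case False
      then have "(2::nat) ^ (K n + c + 1) \<le> 2 ^ (2 * K n + 1)"
        by (intro power_increasing) (auto simp: k0_def)
      then have "T (K n) < m n"
        using T(2)[of "K n"] False unfolding m_def by (simp only: if_False order_less_le_trans)
      have "(\<Sum>t<m n. of_bool (q t n \<in> B) * d t n) = (\<Sum>t<m n. if t = T (K n) then d t n else 0)"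
        by (rule sum.cong) (auto simp: q_def B)
      also have "\<dots> = d (T (K n)) n" using \<open>T (K n) < m n\<close> by simp
      also have "\<dots> = of_bool (n \<in> A)"
        using initial_segment_bit[OF K[of n], of A] by (simp add: d_def T(1))
      finally show ?thesis using False by (simp add: a_def)
    qed (simp add: a_def m_def)
    then have "reduces p B A" using p[of B] unfolding reduces_def by metis
    moreover have "total_for_all_oracles p" using p unfolding total_for_all_oracles_def by blast
    moreover have "use_function B p n \<le> h n" for n
    proof -
      have queries: "queries B p k = (\<lambda>t. q t k) ` {..<m k}" for k by (rule queries_eq[OF p])
      have "q t k < h n" if k: "k < n" and t: "t < m k" for k t
      proof -
        have "k0 \<le> K k" using t by (simp add: m_def split: if_splits)
        then obtain i where i: "K k = Suc i" "e \<le> K k" by (cases "K k") (auto simp: k0_def)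
        have "t \<le> 2 ^ (2 * K k + 1)" using t by (simp add: m_def split: if_splits)
        then have "q t k < b (K k)"
          unfolding q_def b_def less_Suc_eq_le using i(2) by (intro prod_encode_mono order_refl)
        also have "b (K k) \<le> h (g i)" using g(2)[of i] i(1) by simp
        \<comment> \<open>By minimality of \<open>K k\<close>, the bit \<open>k\<close> is not
          covered by the preceding block.\<close>
        also have "g i \<le> k"
          using not_less_Least[of i "\<lambda>j. k < g j"] i(1) by (simp add: K_def)
        then have "h (g i) \<le> h n" using k by (intro monoD[OF h'(2)]) simp
        finally show ?thesis .
      qed
      then have "(\<Union>k<n. queries B p k) \<subseteq> {..<h n}" unfolding queries by auto
      moreover have "finite (queries B p k)" for k unfolding queries by simp
      ultimately show ?thesis using use_function_le_iff by metis
    qed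
    ultimately show ?thesis by blast
  qed
  then show ?thesis by blast
qed

text \<open>Columns of the oracle are numbered by programs.\<close>

instance program :: countable
  by countable_datatype

text \<open>Each order function is named by one program computing it. A program determines its
  function, so different order functions get different columns.\<close>

theorem tt_tu_reducible_if_Schnorr_trivial:
  assumes A: "Schnorr_trivial A"
  shows "\<exists>B. A \<le>\<^sub>t\<^sub>t\<^sub>t\<^sub>u B"
proof -
  define prog where "prog h = (SOME p. oracle_free p \<and> (\<forall>n. computes {} p [n] (h n) {}))" for h
  have prog: "computes {} (prog h) [n] (h n) {}" if "order_function h" for h n
  proof -
    have "\<exists>p. oracle_free p \<and> (\<forall>n. computes {} p [n] (h n) {})"
      using that unfolding order_function_def recursive_def by simp
    from someI_ex[OF this] show ?thesis unfolding prog_def by simp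
  qed
  have prog_inj: "h = h'" if "order_function h" "order_function h'" "prog h = prog h'" for h h'
  proof
    show "h n = h' n" for n
      using computes_deterministic[OF prog[OF that(1)]] prog[OF that(2)] that(3) by metis
  qed
  define codes where "codes h T \<longleftrightarrow>
    (\<forall>B e. (\<forall>k t. prod_encode (e, prod_encode (k, t)) \<in> B \<longleftrightarrow> t = T k) \<longrightarrow>
      (\<exists>p. total_for_all_oracles p \<and> reduces p B A \<and> (\<forall>n. use_function B p n \<le> h n)))" for h T
  have "\<forall>h. \<exists>T. order_function h \<longrightarrow> codes h T"
    using reduction_from_codes[OF A] unfolding codes_def by blast
  from choice[OF this] obtain T where T: "\<And>h. order_function h \<Longrightarrow> codes h (T h)" by blast
  define B where "B = {prod_encode (to_nat (prog h), prod_encode (k, T h k)) | h k. order_function h}"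
  have "A \<le>\<^sub>t\<^sub>t\<^sub>t\<^sub>u B" unfolding tt_tu_reducible_def
  proof (intro allI impI)
    fix h assume h: "order_function h"
    then have "\<forall>k t. prod_encode (to_nat (prog h), prod_encode (k, t)) \<in> B \<longleftrightarrow> t = T h k"
      using prog_inj unfolding B_def by auto
    with T[OF h] show "\<exists>p. total_for_all_oracles p \<and> reduces p B A \<and> (\<forall>n. use_function B p n \<le> h n)"
      unfolding codes_def by blast
  qed
  then show ?thesis ..
qed

theorem theorem3p11:
  fixes A :: "nat set"
  shows "(\<exists>B. A \<le>\<^sub>t\<^sub>t\<^sub>t\<^sub>u B) \<longleftrightarrow> Schnorr_trivial A"
  using Schnorr_trivial_if_tt_tu_reducible tt_tu_reducible_if_Schnorr_trivial by blast

end
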